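(* Let $$X(t)=\sum_{\ell=0}^\infty\sum_{m=-\ell}^{\ell}\Big(e^{-\ell(\ell+1)t}X^0_{\ell,m}+\int_0^t e^{-\ell(\ell+1)(t-s)}\,\mathrm{d}L_{\ell,m}(s)\Big)Y_{\ell,m}$$ and, for $\kappa\in\mathbb{N}$, let $X^{(\kappa)}(t)$ be its spectral approximation, i.e. the same expression with the sum over $\ell$ truncated to $0\le\ell\le\kappa$. Let $\varphi:L^2(\mathbb{S}^2)\to\mathbb{R}$ be a Fréchet differentiable test function such that for some fixed $\rho\ge0$ there is a constant $K<\infty$ (independent of $t$ and $\kappa$) with $$\Big\|\int_0^1\varphi'\big(yX(t)+(1-y)X^{(\kappa)}(t)\big)\,\mathrm{d}y\Big\|_{L^2(\Omega,H^\rho(\mathbb{S}^2))}\le K\quad\text{for all }t\in[0,T].$$ Assume that one of the following holds: (a) $L\in L^2(\Omega,H^\eta(\mathbb{S}^2))$ for some $\eta\in(-1,\infty)$ with expansion $L(t)=\sum_{\ell,m}L_{\ell,m}(t)Y_{\ell,m}$ converging in $L^2(\Omega,H^\eta(\mathbb{S}^2))$, i.e. $\sum_{\ell=0}^\infty\sum_{m=-\ell}^\ell(1+\ell(\ell+1))^\eta(v_{\ell,m}+\widetilde m_{\ell,m}^2)<\infty$; in this case set $\beta=\eta+1$; (b) for some $\alpha>0$, $L_{\ell,m}=a_\ell\hat L_{\ell,m}$ for all $\ell,m$, where $a_0\ge0$, $|a_\ell|\le C'\ell^{-\alpha/2}$ for all $\ell\in\mathbb{N}$ and some constant $C'$, and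 $(\hat L_{\ell,m})_{\ell\in\mathbb{N}_0,m\in\{-\ell,\dots,\ell\}}$ is a sequence of identically distributed real-valued Lévy processes with mean $\mathbb{E}[\hat L_{\ell,m}(t)]=t\hat m$ and variance $\mathbb{E}[(\hat L_{\ell,m}(t)-\mathbb{E}[\hat L_{\ell,m}(t)])^2]=t\hat v$; in this case set $\beta=\alpha/2$. Then there is a finite constant $C$, independent of $\kappa$ and $t$, such that for all $\kappa\in\mathbb{N}$ and $t\in[0,T]$ $$\big|\mathbb{E}[\varphi(X(t))-\varphi(X^{(\kappa)}(t))]\big|\le C e^{-(\kappa+1)^2t}(\kappa+1)^{-\rho}\|X^0\|_{L^2(\Omega,L^2(\mathbb{S}^2))}+C\kappa^{-(\beta+\rho)}.$$
   Context: $\mathbb{S}^2$ is the unit sphere in $\mathbb{R}^3$ with surface measure, $\Delta_{\mathbb{S}^2}$ its Laplace--Beltrami operator, and $(Y_{\ell,m})_{\ell\in\mathbb{N}_0,\,m\in\{-\ell,\dots,\ell\}}$ the real-valued spherical harmonics, an orthonormal basis of $L^2(\mathbb{S}^2)$ with $\Delta_{\mathbb{S}^2}Y_{\ell,m}=-\ell(\ell+1)Y_{\ell,m}$. For $\eta\in\mathbb{R}$, $H^\eta(\mathbb{S}^2)=(\mathrm{Id}-\Delta_{\mathbb{S}^2})^{-\eta/2}L^2(\mathbb{S}^2)$ (distributions for $\eta<0$), with norm $\|f\|_{H^\eta(\mathbb{S}^2)}^2=\sum_{\ell,m}(1+\ell(\ell+1))^\eta f_{\ell,m}^2$ for $f=\sum_{\ell,m}f_{\ell,m}Y_{\ell,m}$;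 $H^0=L^2$. $\|Z\|_{L^p(\Omega,H^\eta(\mathbb{S}^2))}=\mathbb{E}[\|Z\|_{H^\eta(\mathbb{S}^2)}^p]^{1/p}$. The derivative $\varphi'(f)$ is identified with an element of $L^2(\mathbb{S}^2)$ via the Riesz isomorphism. $(\Omega,\mathcal{F},(\mathcal{F}_t)_{t\in[0,T]},\mathbb{P})$ is a complete filtered probability space, $T<\infty$. $L$ is a square-integrable Lévy process (stationary independent increments, stochastically continuous, $L(0)=0$, càdlàg) with values in $H^\eta(\mathbb{S}^2)$ for some $\eta\in(-1,\infty)$, expanded as $L(t)=\sum_{\ell,m}L_{\ell,m}(t)Y_{\ell,m}$ with real-valued càdlàg Lévy processes $L_{\ell,m}$ (in general not assumed independent). Set $\widetilde m_{\ell,m}=\mathbb{E}[L_{\ell,m}(1)]$ and $v_{\ell,m}=\mathbb{E}[(L_{\ell,m}(1)-\mathbb{E}[L_{\ell,m}(1)])^2]$. The initial value $X^0\in L^2(\Omega,L^2(\mathbb{S}^2))$ is $\mathcal{F}_0$-measurable and independent of $L$, and $X^0_{\ell,m}=\langle X^0,Y_{\ell,m}\rangle_{L^2(\mathbb{S}^2)}$. $X$ is the mild solution of $\mathrm{d}X(t)=\Delta_{\mathbb{S}^2}X(t)\,\mathrm{d}t+\mathrm{d}L(t)$, $X(0)=X^0$. *)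

theory Defs
  imports "HOL-Probability.Probability" "HOL-Computational_Algebra.Polynomial"
    "HOL-Library.Function_Algebras"
begin

section \<open>The space \<open>L\<^sup>2\<close> of the unit sphere\<close>

definition sphere_coord :: "real \<times> real \<Rightarrow> real ^ 3" where
  "sphere_coord = (\<lambda>(\<theta>, \<phi>). vector [sin \<theta> * cos \<phi>, sin \<theta> * sin \<phi>, cos \<theta>])"

text \<open>Surface measure, \<open>d\<sigma> = sin \<theta> d\<theta> d\<phi>\<close> in spherical coordinates.\<close>

definition sphere_measure :: "(real ^ 3) measure" where
  "sphere_measure =
     distr (density (restrict_space lborel ({0..pi} \<times> {0..2 * pi})) (\<lambda>(\<theta>, \<phi>). ennreal (sin \<theta>)))
       (restrict_space borel (sphere 0 1)) sphere_coord"

definition square_integrable :: "(real ^ 3 \<Rightarrow> real) \<Rightarrow> bool" where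
  "square_integrable f \<longleftrightarrow> f \<in> borel_measurable sphere_measure
     \<and> integrable sphere_measure (\<lambda>x. (f x)\<^sup>2)"

lemma square_integrable_zero: "square_integrable (\<lambda>_. 0)"
  by (simp add: square_integrable_def)

lemma square_integrable_mult:
  assumes "square_integrable f" "square_integrable g"
  shows "integrable sphere_measure (\<lambda>x. f x * g x)"
proof (rule Bochner_Integration.integrable_bound)
  show "integrable sphere_measure (\<lambda>x. (f x)\<^sup>2 + (g x)\<^sup>2)"
    using assms by (simp add: square_integrable_def)
  show "(\<lambda>x. f x * g x) \<in> borel_measurable sphere_measure"
    using assms by (auto simp: square_integrable_def)
  have "\<bar>a * b\<bar> \<le> a\<^sup>2 + b\<^sup>2" for a b :: real
  proof -
    have "2 * (\<bar>a\<bar> * \<bar>b\<bar>) \<le> a\<^sup>2 + b\<^sup>2"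
      using sum_squares_bound[of "\<bar>a\<bar>" "\<bar>b\<bar>"] by (simp add: mult.assoc)
    moreover have "0 \<le> \<bar>a\<bar> * \<bar>b\<bar>" by simp
    ultimately have "\<bar>a\<bar> * \<bar>b\<bar> \<le> a\<^sup>2 + b\<^sup>2" by linarith
    then show ?thesis by (simp only: abs_mult)
  qed
  then show "AE x in sphere_measure. norm (f x * g x) \<le> norm ((f x)\<^sup>2 + (g x)\<^sup>2)"
    by simp
qed

lemma square_integrable_scale:
  assumes "square_integrable f"
  shows "square_integrable (\<lambda>x. c * f x)"
  using assms by (auto simp: square_integrable_def power_mult_distrib)

lemma square_integrable_add:
  assumes "square_integrable f" "square_integrable g"
  shows "square_integrable (\<lambda>x. f x + g x)"
proof -
  have "integrable sphere_measure (\<lambda>x. (f x)\<^sup>2 + (g x)\<^sup>2 + 2 * (f x * g x))"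
    using assms square_integrable_mult[OF assms] by (simp add: square_integrable_def)
  moreover have "(\<lambda>x. (f x + g x)\<^sup>2) = (\<lambda>x. (f x)\<^sup>2 + (g x)\<^sup>2 + 2 * (f x * g x))"
    by (auto simp: power2_sum)
  ultimately show ?thesis using assms by (auto simp: square_integrable_def)
qed

lemma square_integrable_uminus:
  assumes "square_integrable f"
  shows "square_integrable (\<lambda>x. - f x)"
  using square_integrable_scale[OF assms, of "-1"] by simp

lemma square_integrable_diff:
  assumes "square_integrable f" "square_integrable g"
  shows "square_integrable (\<lambda>x. f x - g x)"
  using square_integrable_add[OF assms(1) square_integrable_uminus[OF assms(2)]] by simp

definition l2_eq :: "(real ^ 3 \<Rightarrow> real) \<Rightarrow> (real ^ 3 \<Rightarrow> real) \<Rightarrow> bool" where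
  "l2_eq f g \<longleftrightarrow> square_integrable f \<and> square_integrable g \<and> (AE x in sphere_measure. f x = g x)"

lemma l2_eq_part_equivp: "part_equivp l2_eq"
proof (rule part_equivpI)
  show "\<exists>x. l2_eq x x" using square_integrable_zero by (auto simp: l2_eq_def)
  show "symp l2_eq" by (auto simp: symp_def l2_eq_def)
  show "transp l2_eq" by (auto simp: transp_def l2_eq_def)
qed

quotient_type l2_sphere = "real ^ 3 \<Rightarrow> real" / partial: l2_eq
  by (rule l2_eq_part_equivp)

instantiation l2_sphere :: real_vector
begin

lift_definition zero_l2_sphere :: l2_sphere is "\<lambda>_. 0"
  by (simp add: l2_eq_def square_integrable_zero)

lift_definition plus_l2_sphere :: "l2_sphere \<Rightarrow> l2_sphere \<Rightarrow> l2_sphere" is "\<lambda>f g x. f x + g x"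
  by (auto simp: l2_eq_def square_integrable_add)

lift_definition minus_l2_sphere :: "l2_sphere \<Rightarrow> l2_sphere \<Rightarrow> l2_sphere" is "\<lambda>f g x. f x - g x"
  by (auto simp: l2_eq_def square_integrable_diff)

lift_definition uminus_l2_sphere :: "l2_sphere \<Rightarrow> l2_sphere" is "\<lambda>f x. - f x"
  by (auto simp: l2_eq_def square_integrable_uminus)

lift_definition scaleR_l2_sphere :: "real \<Rightarrow> l2_sphere \<Rightarrow> l2_sphere" is "\<lambda>c f x. c * f x"
  by (auto simp: l2_eq_def square_integrable_scale)

instance
  by standard
    (transfer; simp add: l2_eq_def square_integrable_add square_integrable_zero
      square_integrable_diff square_integrable_uminus square_integrable_scale algebra_simps)+

end

instantiation l2_sphere :: real_inner
begin

lift_definition inner_l2_sphere :: "l2_sphere \<Rightarrow> l2_sphere \<Rightarrow> real"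
  is "\<lambda>f g. \<integral>x. f x * g x \<partial>sphere_measure"
proof -
  fix f f' g g' assume "l2_eq f f'" "l2_eq g g'"
  then show "(\<integral>x. f x * g x \<partial>sphere_measure) = (\<integral>x. f' x * g' x \<partial>sphere_measure)"
    by (intro integral_cong_AE) (auto simp: l2_eq_def square_integrable_def)
qed

definition norm_l2_sphere :: "l2_sphere \<Rightarrow> real" where
  "norm_l2_sphere f = sqrt (inner f f)"

definition dist_l2_sphere :: "l2_sphere \<Rightarrow> l2_sphere \<Rightarrow> real" where
  "dist_l2_sphere f g = norm (f - g)"

definition sgn_l2_sphere :: "l2_sphere \<Rightarrow> l2_sphere" where
  "sgn_l2_sphere f = f /\<^sub>R norm f"

definition uniformity_l2_sphere :: "(l2_sphere \<times> l2_sphere) filter" where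
  "uniformity_l2_sphere = (INF e\<in>{0 <..}. principal {(f, g). dist f g < e})"

definition open_l2_sphere :: "l2_sphere set \<Rightarrow> bool" where
  "open_l2_sphere U \<longleftrightarrow> (\<forall>x\<in>U. eventually (\<lambda>(x', y). x' = x \<longrightarrow> y \<in> U) uniformity)"

instance
proof
  fix f g h :: l2_sphere and c :: real
  show "inner f g = inner g f"
    by transfer (simp add: mult.commute)
  show "inner (f + g) h = inner f h + inner g h"
    by transfer (simp add: l2_eq_def distrib_right square_integrable_mult)
  show "inner (c *\<^sub>R f) g = c * inner f g"
    by transfer (simp add: mult.assoc)
  show "0 \<le> inner f f"
    by transfer simp
  show "inner f f = 0 \<longleftrightarrow> f = 0"
  proof transfer
    fix f assume "l2_eq f f"
    then have f: "square_integrable f" by (simp add: l2_eq_def)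
    have "(\<integral>x. f x * f x \<partial>sphere_measure) = 0 \<longleftrightarrow> (AE x in sphere_measure. f x * f x = 0)"
      by (rule integral_nonneg_eq_0_iff_AE[OF square_integrable_mult[OF f f]]) simp
    then show "(\<integral>x. f x * f x \<partial>sphere_measure) = 0 \<longleftrightarrow> l2_eq f (\<lambda>_. 0)"
      using f by (simp add: l2_eq_def square_integrable_zero)
  qed
qed (simp_all add: norm_l2_sphere_def dist_l2_sphere_def sgn_l2_sphere_def
      uniformity_l2_sphere_def open_l2_sphere_def)

end

section \<open>Real spherical harmonics\<close>

definition legendre :: "nat \<Rightarrow> real poly" where
  "legendre l = smult (1 / (2 ^ l * fact l)) ((pderiv ^^ l) ([:- 1, 0, 1:] ^ l))"

definition assoc_legendre :: "nat \<Rightarrow> nat \<Rightarrow> real \<Rightarrow> real" where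
  "assoc_legendre l m \<mu> = (- 1) ^ m * sqrt (1 - \<mu>\<^sup>2) ^ m * poly ((pderiv ^^ m) (legendre l)) \<mu>"

definition harm_const :: "nat \<Rightarrow> nat \<Rightarrow> real" where
  "harm_const l m = sqrt ((2 * real l + 1) / (4 * pi) * (fact (l - m) / fact (l + m)))"

text \<open>
  With \<open>x = sphere_coord (\<theta>, \<phi>)\<close> one has \<open>(x\<^sub>1 + i x\<^sub>2)\<^sup>m = (sin \<theta>)\<^sup>m (cos (m \<phi>) + i sin (m \<phi>))\<close>,
  which absorbs the factor \<open>(1 - \<mu>\<^sup>2)\<^bsup>m/2\<^esup>\<close> of the associated Legendre function at \<open>\<mu> = cos \<theta>\<close>;
  see the lemma \<open>harm_fun_sphere_coord\<close> for the form in spherical coordinates.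
\<close>

definition harm_fun :: "nat \<Rightarrow> int \<Rightarrow> real ^ 3 \<Rightarrow> real" where
  "harm_fun l m x =
     (let k = nat \<bar>m\<bar>;
          r = harm_const l k * (- 1) ^ k * poly ((pderiv ^^ k) (legendre l)) (x $ 3);
          z = Complex (x $ 1) (x $ 2) ^ k
      in if m = 0 then r else if m > 0 then sqrt 2 * r * Re z else sqrt 2 * r * Im z)"

lemma harm_fun_sphere_coord:
  assumes "0 \<le> \<theta>" "\<theta> \<le> pi"
  shows "harm_fun l m (sphere_coord (\<theta>, \<phi>)) =
    (if m = 0 then harm_const l 0 * assoc_legendre l 0 (cos \<theta>)
     else if m > 0 then sqrt 2 * harm_const l (nat m) * assoc_legendre l (nat m) (cos \<theta>) * cos (m * \<phi>)
     else sqrt 2 * harm_const l (nat \<bar>m\<bar>) * assoc_legendre l (nat \<bar>m\<bar>) (cos \<theta>) * sin (\<bar>m\<bar> * \<phi>))"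
proof -
  have s: "sqrt (1 - (cos \<theta>)\<^sup>2) = sin \<theta>"
    using sin_ge_zero[OF assms] by (simp add: sin_squared_eq[symmetric])
  have "Complex (sin \<theta> * cos \<phi>) (sin \<theta> * sin \<phi>) = complex_of_real (sin \<theta>) * cis \<phi>"
    by (simp add: complex_eq_iff)
  then have "Complex (sin \<theta> * cos \<phi>) (sin \<theta> * sin \<phi>) ^ k = complex_of_real (sin \<theta> ^ k) * cis (real k * \<phi>)"
    for k by (simp add: power_mult_distrib Complex.DeMoivre)
  then show ?thesis
    by (simp add: harm_fun_def assoc_legendre_def sphere_coord_def vector_3 Let_def s)
qed

lemma continuous_on_harm_fun: "continuous_on UNIV (harm_fun l m)"
proof -
  have 1: "continuous_on UNIV (\<lambda>x::real^3. poly p (x $ 3))" for p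
    by (intro continuous_intros)
  have "continuous_on UNIV (\<lambda>x::real^3. Complex (x $ 1) (x $ 2))"
    unfolding Complex_eq by (intro continuous_intros)
  then have 2: "continuous_on UNIV (\<lambda>x::real^3. Complex (x $ 1) (x $ 2) ^ k)" for k
    by (intro continuous_intros)
  show ?thesis
    unfolding harm_fun_def Let_def
    by (cases "m = 0"; cases "m > 0") (simp_all, (intro continuous_intros 1 2)+)
qed

lemma space_sphere_measure [simp]: "space sphere_measure = sphere 0 1"
  by (simp add: sphere_measure_def space_restrict_space)

lemma measurable_sphere_coord:
  "sphere_coord \<in> density (restrict_space lborel ({0..pi} \<times> {0..2 * pi})) (\<lambda>(\<theta>, \<phi>). ennreal (sin \<theta>))
     \<rightarrow>\<^sub>M restrict_space borel (sphere 0 1)"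
proof -
  have 1: "sphere_coord \<in> borel_measurable borel"
  proof (rule borel_measurable_continuous_onI)
    have e: "sphere_coord = (\<lambda>p. \<chi> i. if i = 1 then sin (fst p) * cos (snd p)
        else if i = 2 then sin (fst p) * sin (snd p) else cos (fst p))"
      by (auto simp: sphere_coord_def fun_eq_iff vec_eq_iff forall_3 vector_3)
    have "continuous_on UNIV (\<lambda>p::real\<times>real. if i = 1 then sin (fst p) * cos (snd p)
        else if i = 2 then sin (fst p) * sin (snd p) else cos (fst p))" for i :: 3
      by (cases "i = 1"; cases "i = 2") (simp_all, (intro continuous_intros)+)
    then show "continuous_on UNIV sphere_coord"
      unfolding e by (intro continuous_on_vec_lambda)
  qed
  have 2: "sphere_coord p \<in> sphere 0 1" for p
  proof -
    obtain a b where p: "p = (a, b)" by (cases p)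
    have "(norm (sphere_coord p))\<^sup>2 = (sin a * cos b)\<^sup>2 + (sin a * sin b)\<^sup>2 + (cos a)\<^sup>2"
      unfolding power2_norm_eq_inner
      by (simp only: p inner_vec_def sum_3 sphere_coord_def vector_3 power2_eq_square prod.case inner_real_def)
    also have "\<dots> = (sin a)\<^sup>2 * ((cos b)\<^sup>2 + (sin b)\<^sup>2) + (cos a)\<^sup>2"
      by (simp only: power_mult_distrib distrib_left)
    also have "\<dots> = 1"
      by (simp only: sin_cos_squared_add2 mult_1_right sin_cos_squared_add)
    finally have "(norm (sphere_coord p))\<^sup>2 = 1" .
    then have "norm (sphere_coord p) = 1"
      using norm_ge_zero[of "sphere_coord p"] by (auto simp: power2_eq_1_iff)
    then show ?thesis by simp
  qed
  show ?thesis
    using 1 2 by (intro measurable_restrict_space2) (auto intro!: measurable_restrict_space1)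
qed

lemma finite_measure_sphere: "finite_measure sphere_measure"
proof -
  let ?Q = "{0..pi} \<times> {0..2 * pi}"
  let ?N = "restrict_space lborel ?Q"
  let ?D = "density ?N (\<lambda>(\<theta>, \<phi>). ennreal (sin \<theta>))"
  have Q: "?Q \<in> sets borel"
    by (intro borel_closed closed_Times closed_atLeastAtMost)
  have "(\<lambda>p::real\<times>real. ennreal (sin (fst p))) \<in> borel_measurable borel"
    by (intro measurable_compose[OF _ measurable_ennreal] borel_measurable_continuous_onI continuous_intros)
  then have m: "(\<lambda>(\<theta>::real, \<phi>::real). ennreal (sin \<theta>)) \<in> borel_measurable ?N"
    by (auto simp: case_prod_unfold intro!: measurable_restrict_space1)
  have "emeasure ?D (space ?D) = (\<integral>\<^sup>+p. (case p of (\<theta>, \<phi>) \<Rightarrow> ennreal (sin \<theta>)) * indicator (space ?N) p \<partial>?N)"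
    using m by (simp add: emeasure_density)
  also have "\<dots> \<le> (\<integral>\<^sup>+p. 1 \<partial>?N)"
    by (intro nn_integral_mono) (auto simp: indicator_def ennreal_le_1)
  also have "\<dots> = emeasure lborel ?Q"
    using Q by (simp add: emeasure_restrict_space space_restrict_space)
  also have "\<dots> < \<infinity>"
    using emeasure_lborel_cbox_finite[of "(0, 0)" "(pi, 2 * pi)"]
    by (simp only: cbox_Pair_eq cbox_interval[symmetric] infinity_ennreal_def)
  finally have "finite_measure ?D"
    by (intro finite_measureI) auto
  then show ?thesis
    unfolding sphere_measure_def by (rule finite_measure.finite_measure_distr[OF _ measurable_sphere_coord])
qed

lemma square_integrable_harm_fun: "square_integrable (harm_fun l m)"
proof -
  have c: "continuous_on (sphere 0 1) (harm_fun l m)"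
    using continuous_on_harm_fun continuous_on_subset by blast
  then have meas: "harm_fun l m \<in> borel_measurable sphere_measure"
    using borel_measurable_continuous_on_restrict[OF c]
    by (simp add: sphere_measure_def measurable_distr_eq1 cong: measurable_cong_sets)
  have "compact (harm_fun l m ` sphere 0 1)"
    by (rule compact_continuous_image[OF c]) simp
  then have "bounded (harm_fun l m ` sphere 0 1)"
    by (rule compact_imp_bounded)
  then obtain B where "\<forall>y\<in>harm_fun l m ` sphere 0 1. norm y \<le> B"
    unfolding bounded_iff by blast
  then have B: "\<bar>harm_fun l m x\<bar> \<le> B" if "x \<in> sphere 0 1" for x
    using that by (metis imageI real_norm_def)
  have "(harm_fun l m x)\<^sup>2 \<le> B\<^sup>2" if "x \<in> sphere 0 1" for x
    using power_mono[OF B[OF that], of 2] by simp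
  then have "AE x in sphere_measure. norm ((harm_fun l m x)\<^sup>2) \<le> B\<^sup>2"
    by (intro AE_I2) simp
  then have "integrable sphere_measure (\<lambda>x. (harm_fun l m x)\<^sup>2)"
    using meas by (intro finite_measure.integrable_const_bound[OF finite_measure_sphere]) auto
  then show ?thesis using meas by (simp add: square_integrable_def)
qed

lift_definition harm :: "nat \<Rightarrow> int \<Rightarrow> l2_sphere" is harm_fun
  by (simp add: l2_eq_def square_integrable_harm_fun)

section \<open>Sobolev spaces\<close>

text \<open>
  An element \<open>f = \<Sum>\<^sub>l\<^sub>,\<^sub>m f\<^sub>l\<^sub>,\<^sub>m Y\<^sub>l\<^sub>,\<^sub>m\<close> of \<open>H\<^sup>\<eta> = (Id - \<Delta>)\<^bsup>-\<eta>/2\<^esup> L\<^sup>2\<close> (a distribution when \<open>\<eta> < 0\<close>) is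
  represented by its coefficients \<open>f l m\<close>, \<open>\<bar>m\<bar> \<le> l\<close>; the junk entries with \<open>\<bar>m\<bar> > l\<close> are zero.
  The operator \<open>Id - \<Delta>\<close> is diagonal with eigenvalues \<open>1 + l (l + 1)\<close>.
\<close>

type_synonym coeffs = "nat \<Rightarrow> int \<Rightarrow> real"

definition sobolev_sq :: "real \<Rightarrow> coeffs \<Rightarrow> nat \<Rightarrow> real" where
  "sobolev_sq \<eta> f l = (\<Sum>m = - int l..int l. (1 + real l * (real l + 1)) powr \<eta> * (f l m)\<^sup>2)"

definition sobolev :: "real \<Rightarrow> coeffs set" where
  "sobolev \<eta> = {f. (\<forall>l m. int l < \<bar>m\<bar> \<longrightarrow> f l m = 0) \<and> summable (sobolev_sq \<eta> f)}"

definition sobolev_norm :: "real \<Rightarrow> coeffs \<Rightarrow> real" where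
  "sobolev_norm \<eta> f = sqrt (\<Sum>l. sobolev_sq \<eta> f l)"

text \<open>The Borel sets of \<open>H\<^sup>\<eta>\<close>, generated by the norm-open sets.\<close>

definition sobolev_borel :: "real \<Rightarrow> coeffs measure" where
  "sobolev_borel \<eta> = sigma (sobolev \<eta>)
     {U. U \<subseteq> sobolev \<eta> \<and>
         (\<forall>f\<in>U. \<exists>e>0. \<forall>g\<in>sobolev \<eta>. sobolev_norm \<eta> (\<lambda>l m. g l m - f l m) < e \<longrightarrow> g \<in> U)}"

definition sph_coeffs :: "l2_sphere \<Rightarrow> coeffs" where
  "sph_coeffs f l m = (if \<bar>m\<bar> \<le> int l then inner f (harm l m) else 0)"

text \<open>\<open>L\<^sup>2(\<Omega>, V)\<close> norm, for \<open>V\<close> with norm \<open>N\<close>.\<close>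

definition L2_norm :: "'w measure \<Rightarrow> ('v \<Rightarrow> real) \<Rightarrow> ('w \<Rightarrow> 'v) \<Rightarrow> real" where
  "L2_norm M N Z = sqrt (\<integral>\<omega>. (N (Z \<omega>))\<^sup>2 \<partial>M)"

definition L2_sobolev :: "'w measure \<Rightarrow> real \<Rightarrow> ('w \<Rightarrow> coeffs) set" where
  "L2_sobolev M \<eta> = {Z. Z \<in> M \<rightarrow>\<^sub>M sobolev_borel \<eta> \<and> integrable M (\<lambda>\<omega>. (sobolev_norm \<eta> (Z \<omega>))\<^sup>2)}"

section \<open>Levy processes\<close>

text \<open>
  Levy processes indexed by \<open>{0..}\<close> with values in a space with norm \<open>N\<close> and Borel \<open>\<sigma>\<close>-algebra \<open>B\<close>
  (the carrier is \<open>space B\<close>). Used with \<open>B = borel\<close>, \<open>N = abs\<close> for real-valued processes, and with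
  \<open>B = sobolev_borel \<eta>\<close>, \<open>N = sobolev_norm \<eta>\<close>.
\<close>

definition levy_process ::
  "'w measure \<Rightarrow> 'v::ab_group_add measure \<Rightarrow> ('v \<Rightarrow> real) \<Rightarrow> (real \<Rightarrow> 'w \<Rightarrow> 'v) \<Rightarrow> bool" where
  "levy_process M B N Z \<longleftrightarrow>
     (\<forall>t\<ge>0. Z t \<in> M \<rightarrow>\<^sub>M B) \<and>
     (AE \<omega> in M. Z 0 \<omega> = 0) \<and>
     (\<forall>(n::nat) p. 0 \<le> p 0 \<and> (\<forall>i<n. p i < p (Suc i)) \<longrightarrow>
        prob_space.indep_vars M (\<lambda>_. B) (\<lambda>i \<omega>. Z (p (Suc i)) \<omega> - Z (p i) \<omega>) {..<n}) \<and>
     (\<forall>s\<ge>0. \<forall>h\<ge>0. distr M B (\<lambda>\<omega>. Z (s + h) \<omega> - Z s \<omega>) = distr M B (Z h)) \<and>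
     (\<forall>s\<ge>0. \<forall>e>0. ((\<lambda>t. measure M {\<omega> \<in> space M. N (Z t \<omega> - Z s \<omega>) > e}) \<longlongrightarrow> 0) (at s within {0..})) \<and>
     (AE \<omega> in M.
        (\<forall>t\<ge>0. ((\<lambda>s. N (Z s \<omega> - Z t \<omega>)) \<longlongrightarrow> 0) (at_right t)) \<and>
        (\<forall>t>0. \<exists>z\<in>space B. ((\<lambda>s. N (Z s \<omega> - z)) \<longlongrightarrow> 0) (at_left t)))"

text \<open>
  The integral \<open>\<integral>\<^sub>0\<^sup>t f(s) dZ(s)\<close> of a deterministic \<open>f\<close> against a real square-integrable Levy
  process \<open>Z\<close>: for a step function it is the sum of the weighted increments, and it is extended
  by \<open>L\<^sup>2\<close>-continuity from step functions to \<open>f \<in> L\<^sup>2(0, t)\<close>. It is thus a random variable \<open>I\<close>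
  determined up to almost sure equality.
\<close>

definition step_fun :: "nat \<Rightarrow> (nat \<Rightarrow> real) \<Rightarrow> (nat \<Rightarrow> real) \<Rightarrow> real \<Rightarrow> real" where
  "step_fun n p c s = (\<Sum>i<n. c i * indicator {p i<..p (Suc i)} s)"

definition step_integral ::
  "nat \<Rightarrow> (nat \<Rightarrow> real) \<Rightarrow> (nat \<Rightarrow> real) \<Rightarrow> (real \<Rightarrow> 'w \<Rightarrow> real) \<Rightarrow> 'w \<Rightarrow> real" where
  "step_integral n p c Z \<omega> = (\<Sum>i<n. c i * (Z (p (Suc i)) \<omega> - Z (p i) \<omega>))"

definition has_levy_integral ::
  "'w measure \<Rightarrow> (real \<Rightarrow> 'w \<Rightarrow> real) \<Rightarrow> (real \<Rightarrow> real) \<Rightarrow> real \<Rightarrow> ('w \<Rightarrow> real) \<Rightarrow> bool" where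
  "has_levy_integral M Z f t I \<longleftrightarrow>
     f \<in> borel_measurable lborel \<and> I \<in> borel_measurable M \<and>
     (\<exists>n p c.
        (\<forall>k. p k 0 = 0 \<and> p k (n k) = t \<and> (\<forall>i<n k. p k i < p k (Suc i))) \<and>
        (\<lambda>k. \<integral>\<^sup>+s\<in>{0..t}. ennreal ((f s - step_fun (n k) (p k) (c k) s)\<^sup>2) \<partial>lborel) \<longlonglongrightarrow> 0 \<and>
        (\<lambda>k. \<integral>\<^sup>+\<omega>. ennreal ((I \<omega> - step_integral (n k) (p k) (c k) Z \<omega>)\<^sup>2) \<partial>M) \<longlonglongrightarrow> 0)"

section \<open>Filtrations and the spectral approximation\<close>

definition complete_filtration :: "'w measure \<Rightarrow> real \<Rightarrow> (real \<Rightarrow> 'w measure) \<Rightarrow> bool" where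
  "complete_filtration M T F \<longleftrightarrow>
     (\<forall>t\<in>{0..T}. subalgebra M (F t) \<and> null_sets M \<subseteq> sets (F t)) \<and>
     (\<forall>s t. 0 \<le> s \<and> s \<le> t \<and> t \<le> T \<longrightarrow> subalgebra (F t) (F s))"

definition indep_of_process ::
  "'w measure \<Rightarrow> ('w \<Rightarrow> 'a::topological_space) \<Rightarrow> 'v measure \<Rightarrow> (real \<Rightarrow> 'w \<Rightarrow> 'v) \<Rightarrow> bool" where
  "indep_of_process M X B Z \<longleftrightarrow>
     prob_space.indep_set M {X -` A \<inter> space M | A. A \<in> sets borel}
       (sigma_sets (space M) (\<Union>t\<in>{0..}. {Z t -` A \<inter> space M | A. A \<in> sets B}))"

text \<open>
  The degree \<open>l\<close> part of the solution, given the initial value \<open>X0\<close> and the stochastic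
  convolutions \<open>I l m t\<close>.
\<close>

definition solution_part ::
  "('w \<Rightarrow> l2_sphere) \<Rightarrow> (nat \<Rightarrow> int \<Rightarrow> real \<Rightarrow> 'w \<Rightarrow> real) \<Rightarrow> nat \<Rightarrow> real \<Rightarrow> 'w \<Rightarrow> l2_sphere" where
  "solution_part X0 I l t \<omega> =
     (\<Sum>m = - int l..int l.
        (exp (- (real l * (real l + 1)) * t) * inner (X0 \<omega>) (harm l m) + I l m t \<omega>) *\<^sub>R harm l m)"

definition spectral_approx ::
  "('w \<Rightarrow> l2_sphere) \<Rightarrow> (nat \<Rightarrow> int \<Rightarrow> real \<Rightarrow> 'w \<Rightarrow> real) \<Rightarrow> nat \<Rightarrow> real \<Rightarrow> 'w \<Rightarrow> l2_sphere" where
  "spectral_approx X0 I \<kappa> t \<omega> = (\<Sum>l\<le>\<kappa>. solution_part X0 I l t \<omega>)"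

end

theory Submission
  imports Defs
begin

text \<open>
The error is measured against a dual weight. Along the segment from \<open>X\<^sup>\<kappa>\<close> to \<open>X\<close> the chain rule
gives \<open>\<phi>(X) - \<phi>(X\<^sup>\<kappa>) = \<langle>J, X - X\<^sup>\<kappa>\<rangle>\<close>, where \<open>J\<close> is the averaged derivative, whose \<open>H\<^sup>\<rho>\<close> norm has
second moment at most \<open>K\<^sup>2\<close>. Pairing \<open>H\<^sup>\<rho>\<close> with \<open>H\<^bsup>-\<rho>\<^esup>\<close> and applying the Cauchy-Schwarz inequality on
\<open>\<Omega>\<close> bounds the weak error by \<open>K\<close> times the \<open>L\<^sup>2(\<Omega>, H\<^bsup>-\<rho>\<^esup>)\<close> norm of \<open>X - X\<^sup>\<kappa>\<close>. That difference contains
only modes of degree \<open>l > \<kappa>\<close>, and there the weight \<open>(1 + l(l+1))\<^bsup>-\<rho>\<^esup>\<close> supplies the extra factor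
\<open>\<kappa>\<^bsup>-2\<rho>\<^esup>\<close> in the square. This is \<open>weak_error_bound\<close>.

Each mode splits into an initial and a noise part. In the initial part the heat semigroup contributes
\<open>e\<^bsup>-l(l+1)t\<^esup> \<le> e\<^bsup>-(\<kappa>+1)\<^sup>2t\<^esup>\<close>, and Bessel's inequality (\<open>bessel_harm\<close>) leaves the norm of the initial
value. It rests on orthonormality of the spherical harmonics (\<open>harm_orthonormal\<close>), which separation of
variables reduces to trigonometric integrals and to the associated Legendre functions; the latter are
handled by one integration by parts that raises the order \<open>m\<close> by one (\<open>legendre_integral_step\<close>).

In the noise part, the stochastic convolution with rate \<open>a = l(l+1)\<close> of a mode with mean \<open>\<mu>\<close> and
variance \<open>v\<close> at time \<open>1\<close> has second moment at most a constant times \<open>(v + \<mu>\<^sup>2)/a\<close>, because the mean and the variance of a mode grow linearly in time and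
\<open>\<integral>\<^sub>0\<^sup>t e\<^bsup>-2a(t-s)\<^esup> ds \<le> 1/(2a)\<close> (\<open>levy_convolution_second_moment\<close>). The gain of \<open>1/a\<close> is one order of
smoothness, which explains \<open>\<beta> = \<eta> + 1\<close> when the \<open>H\<^sup>\<eta>\<close> sum of the noise is finite
(\<open>noise_tail_summable\<close>). In the case of a polynomial decay \<open>l\<^bsup>-\<alpha>\<^esup>\<close> of the mode variances it offsets the
\<open>2l + 1\<close> modes of each degree, and the tail of \<open>\<Sum> l\<^bsup>-1-\<alpha>-2\<rho>\<^esup>\<close> gives \<open>\<beta> = \<alpha>/2\<close>
(\<open>noise_tail_polynomial\<close>).
\<close>

section \<open>Legendre polynomials\<close>

lemma smult_of_nat_poly: "smult (of_nat n) p = of_nat n * (p :: real poly)"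
  by (simp add: of_nat_poly)

text \<open>
The polynomial \<open>y = (x\<^sup>2 - 1)\<^sup>l\<close> satisfies \<open>(x\<^sup>2 - 1) y' = 2 l x y\<close>; this is the derivative of order
\<open>k + 1\<close> of that equation, by Leibniz' rule.
\<close>

lemma power_ode_higher:
  fixes l k :: nat
  defines "y \<equiv> \<lambda>j. (pderiv ^^ j) ([:- 1, 0, 1:] ^ l) :: real poly"
  shows "[:- 1, 0, 1:] * y (Suc (Suc k)) + of_nat (2 * Suc k) * [:0, 1:] * y (Suc k)
      + of_nat (k * Suc k) * y k
    = of_nat (2 * l) * [:0, 1:] * y (Suc k) + of_nat (2 * l * Suc k) * y k"
proof -
  define u X where "u = ([:- 1, 0, 1:] :: real poly)" and "X = ([:0, 1:] :: real poly)"
  have u: "pderiv u = 2 * X" "pderiv X = 1"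
    by (simp_all add: pderiv_pCons one_pCons numeral_poly u_def X_def)
  have D: "pderiv (y j) = y (Suc j)" for j by (simp add: y_def)
  show ?thesis unfolding u_def[symmetric] unfolding X_def[symmetric]
  proof (induction k)
    case 0
    have *: "u * y 1 = of_nat (2 * l) * X * y 0"
    proof (cases l)
      case 0 then show ?thesis by (simp add: y_def)
    next
      case (Suc n)
      have "y 1 = of_nat l * u ^ n * (2 * X)"
        by (simp only: y_def Suc pderiv_power_Suc u smult_of_nat_poly u_def[symmetric] funpow.simps
            One_nat_def o_def id_apply)
      then show ?thesis by (simp add: y_def Suc u_def[symmetric])
    qed
    from arg_cong[OF this, of pderiv] show ?case
      unfolding pderiv_add pderiv_mult D u pderiv_of_nat by (simp add: algebra_simps)
  next
    case (Suc k)
    from arg_cong[OF Suc, of pderiv]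
    show ?case
      unfolding pderiv_add pderiv_mult D u pderiv_of_nat by (simp add: algebra_simps)
  qed
qed

text \<open>
The Legendre equation, differentiated \<open>m\<close> times and multiplied by the integrating factor
\<open>(1 - x\<^sup>2)\<^sup>m\<close>. In this divergence form it can be integrated by parts against another derivative.
\<close>

lemma legendre_ode:
  fixes l m :: nat
  defines "P \<equiv> \<lambda>j. (pderiv ^^ j) (legendre l)"
  shows "pderiv ([:1, 0, - 1:] ^ Suc m * P (Suc m))
    = smult ((real l + real m + 1) * (real m - real l)) ([:1, 0, - 1:] ^ m * P m)"
proof -
  define c :: real where "c = 1 / (2 ^ l * fact l)"
  define y where "y = (\<lambda>j. (pderiv ^^ j) ([:- 1, 0, 1:] ^ l) :: real poly)"
  define u X v where "u = ([:- 1, 0, 1:] :: real poly)" and "X = ([:0, 1:] :: real poly)"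
    and "v = ([:1, 0, - 1:] :: real poly)"
  have P: "P j = smult c (y (j + l))" for j
    by (simp add: P_def legendre_def higher_pderiv_smult c_def y_def funpow_add)
  have y: "y j = (pderiv ^^ j) (u ^ l)" for j by (simp add: y_def u_def)
  have D: "pderiv (P j) = P (Suc j)" for j by (simp add: P_def)
  have v: "pderiv v = - 2 * X" and uv: "u = - v"
    by (simp_all add: v_def u_def X_def pderiv_pCons numeral_poly)
  have "pderiv (v ^ Suc m * P (Suc m))
      = v ^ m * (v * P (Suc (Suc m)) - of_nat (2 * Suc m) * X * P (Suc m))"
    unfolding pderiv_mult D pderiv_power_Suc v smult_of_nat_poly by (simp add: algebra_simps)
  also have "v * P (Suc (Suc m)) - of_nat (2 * Suc m) * X * P (Suc m)
      = smult ((real l + real m + 1) * (real m - real l)) (P m)"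
  proof (rule poly_ext)
    fix x
    have "poly u x * poly (y (Suc (Suc (m + l)))) x + (2 * real (Suc (m + l))) * poly X x * poly (y (Suc (m + l))) x
       + (real (m + l) * real (Suc (m + l))) * poly (y (m + l)) x
       = 2 * real l * poly X x * poly (y (Suc (m + l))) x + (2 * real l * real (Suc (m + l))) * poly (y (m + l)) x"
      using arg_cong[OF power_ode_higher[of "m + l" l], of "\<lambda>p. poly p x"]
      unfolding u_def[symmetric] unfolding X_def[symmetric] y[symmetric]
      by (simp only: poly_add poly_mult poly_of_nat of_nat_mult of_nat_numeral poly_numeral)
    from arg_cong[OF this, of "\<lambda>z. c * z"]
    show "poly (v * P (Suc (Suc m)) - of_nat (2 * Suc m) * X * P (Suc m)) x
      = poly (smult ((real l + real m + 1) * (real m - real l)) (P m)) x"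
      unfolding P uv by (simp add: algebra_simps)
  qed
  finally show ?thesis by (simp add: v_def)
qed

text \<open>
After the substitution \<open>x = cos \<theta>\<close> this is the integral of \<open>p\<close> over \<open>[-1, 1]\<close>; the polar-angle form is
the one that occurs in surface integrals.
\<close>

definition zonal_integral :: "real poly \<Rightarrow> real" where
  "zonal_integral p = (\<integral>\<theta>. indicator {0..pi} \<theta> *\<^sub>R (poly p (cos \<theta>) * sin \<theta>) \<partial>lborel)"

lemma zonal_integrable:
  "integrable lborel (\<lambda>\<theta>. indicator {0..pi} \<theta> *\<^sub>R (poly p (cos \<theta>) * sin \<theta>))"
  using borel_integrable_atLeastAtMost'[of 0 pi "\<lambda>\<theta>. poly p (cos \<theta>) * sin \<theta>"]
  unfolding set_integrable_def by (simp add: continuous_intros)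

lemma zonal_integral_add: "zonal_integral (p + q) = zonal_integral p + zonal_integral q"
  unfolding zonal_integral_def
  by (subst Bochner_Integration.integral_add[symmetric, OF zonal_integrable zonal_integrable])
     (simp add: algebra_simps)

lemma zonal_integral_smult: "zonal_integral (smult c p) = c * zonal_integral p"
  unfolding zonal_integral_def
  by (subst integral_mult_right_zero[symmetric]) (simp add: algebra_simps)

lemma zonal_integral_pderiv: "zonal_integral (pderiv p) = poly p 1 - poly p (- 1)"
proof -
  have "zonal_integral (pderiv p) = (- poly p (cos pi)) - (- poly p (cos 0))"
    unfolding zonal_integral_def
  proof (rule integral_FTC_atLeastAtMost)
    show "((\<lambda>\<theta>. - poly p (cos \<theta>)) has_vector_derivative poly (pderiv p) (cos x) * sin x) (at x within {0..pi})" for x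
      by (auto simp flip: has_real_derivative_iff_has_vector_derivative
          intro!: derivative_eq_intros DERIV_chain2[OF poly_DERIV])
  qed (auto intro!: continuous_intros)
  then show ?thesis by simp
qed

text \<open>
Integration by parts moves one derivative off the second factor; the boundary terms vanish because
\<open>(1 - x\<^sup>2)\<^bsup>m+1\<^esup>\<close> does, and \<open>legendre_ode\<close> turns the other side into the integral of order \<open>m\<close>.
\<close>

lemma legendre_integral_step:
  fixes l l' m :: nat
  defines "A \<equiv> \<lambda>m. zonal_integral ([:1, 0, - 1:] ^ m * (pderiv ^^ m) (legendre l) * (pderiv ^^ m) (legendre l'))"
  shows "A (Suc m) = (real l + real m + 1) * (real l - real m) * A m"
proof -
  define P P' v where "P = (\<lambda>j. (pderiv ^^ j) (legendre l))" and "P' = (\<lambda>j. (pderiv ^^ j) (legendre l'))"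
    and "v = ([:1, 0, - 1:] :: real poly)"
  have D: "pderiv (P' j) = P' (Suc j)" for j by (simp add: P'_def)
  have "pderiv (v ^ Suc m * P (Suc m) * P' m) = v ^ Suc m * P (Suc m) * P' (Suc m)
     + smult ((real l + real m + 1) * (real m - real l)) (v ^ m * P m * P' m)"
    unfolding pderiv_mult[of "v ^ Suc m * P (Suc m)"] D
      legendre_ode[of m l, folded v_def, folded fun_cong[OF P_def]]
    by (simp add: mult.commute del: power_Suc)
  from arg_cong[OF this, of zonal_integral]
  have "0 = A (Suc m) + (real l + real m + 1) * (real m - real l) * A m"
    unfolding zonal_integral_add zonal_integral_smult zonal_integral_pderiv
    by (simp add: A_def P_def P'_def v_def del: mult_pCons_left)
  then show ?thesis by (simp add: algebra_simps)
qed

text \<open>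
The integral is symmetric in \<open>l\<close> and \<open>l'\<close>, so \<open>legendre_integral_step\<close> at \<open>m = 0\<close> shows that it is
multiplied by \<open>l(l+1)\<close> and by \<open>l'(l'+1)\<close> with the same result: eigenfunctions to different eigenvalues
are orthogonal. The step then propagates this to all orders.
\<close>

lemma legendre_orthogonal:
  assumes "l \<noteq> l'"
  shows "zonal_integral ([:1, 0, - 1:] ^ m * (pderiv ^^ m) (legendre l) * (pderiv ^^ m) (legendre l')) = 0"
proof (induction m)
  case 0
  let ?A = "\<lambda>m l l'. zonal_integral ([:1, 0, - 1:] ^ m * (pderiv ^^ m) (legendre l) * (pderiv ^^ m) (legendre l'))"
  have s: "?A m l l' = ?A m l' l" for m l l' by (simp only: mult.assoc mult.commute[of "(pderiv ^^ m) (legendre l)"])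
  have "(real l + 1) * real l * ?A 0 l l' = (real l' + 1) * real l' * ?A 0 l l'"
    using legendre_integral_step[of 0 l l'] legendre_integral_step[of 0 l' l] s[of 0 l l'] s[of 1 l l']
    by (simp only: of_nat_0 add_0_right diff_zero One_nat_def)
  moreover have "(real l + 1) * real l \<noteq> (real l' + 1) * real l'"
  proof
    assume "(real l + 1) * real l = (real l' + 1) * real l'"
    then have "(real l - real l') * (real l + real l' + 1) = 0" by (simp add: algebra_simps)
    with assms show False by (auto simp: add_eq_0_iff)
  qed
  ultimately show ?case by auto
next
  case (Suc m)
  then show ?case unfolding legendre_integral_step by simp
qed

lemma zonal_integral_weight:
  "zonal_integral ([:1, 0, - 1:] ^ l) = 2 * (2 ^ l * fact l)\<^sup>2 / fact (2 * l + 1)"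
proof (induction l)
  case 0
  show ?case using zonal_integral_pderiv[of "[:0,1:]"] by (simp add: pderiv_pCons one_pCons)
next
  case (Suc l)
  define X v where "X = ([:0, 1:] :: real poly)" and "v = ([:1, 0, - 1:] :: real poly)"
  have pd: "pderiv (X * v ^ Suc l) = smult (2 * real l + 3) (v ^ Suc l) + smult (- (2 * real l + 2)) (v ^ l)"
  proof -
    have v': "pderiv v = - 2 * X" and X': "pderiv X = 1"
      by (simp_all add: v_def X_def pderiv_pCons numeral_poly one_pCons)
    show ?thesis unfolding pderiv_mult pderiv_power_Suc v' X'
      by (rule poly_ext) (simp add: v_def X_def algebra_simps)
  qed
  moreover have "poly (X * v ^ Suc l) 1 = 0" "poly (X * v ^ Suc l) (- 1) = 0"
    by (simp_all add: v_def)
  ultimately have "(2 * real l + 3) * zonal_integral (v ^ Suc l) = (2 * real l + 2) * zonal_integral (v ^ l)"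
    using arg_cong[OF pd, of zonal_integral]
    unfolding zonal_integral_add zonal_integral_smult zonal_integral_pderiv by linarith
  then have "zonal_integral (v ^ Suc l) = (2 * real l + 2) / (2 * real l + 3) * zonal_integral (v ^ l)"
    by (simp add: field_simps)
  also have "\<dots> = (2 * real l + 2) / (2 * real l + 3) * (2 * (2 ^ l * fact l)\<^sup>2 / fact (2 * l + 1))"
    using Suc by (simp add: v_def)
  also have "\<dots> = 2 * (2 ^ Suc l * fact (Suc l))\<^sup>2 / fact (2 * Suc l + 1)"
  proof -
    have f: "fact (2 * Suc l + 1) = (2 * real l + 3) * ((2 * real l + 2) * fact (2 * l + 1))"
      by (simp add: algebra_simps)
    have n: "(2 * real l + 3) \<noteq> 0" "(2 * real l + 2) \<noteq> 0" by linarith+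
    have g: "2 ^ Suc l * fact (Suc l) = (2 * real l + 2) * (2 ^ l * fact l)" by (simp add: algebra_simps)
    show ?thesis unfolding f g using n
      by (simp add: divide_simps power2_eq_square del: fact_Suc)
  qed
  finally show ?case by (simp add: v_def)
qed

lemma legendre_top_deriv: "(pderiv ^^ l) (legendre l) = [:fact (2 * l) / (2 ^ l * fact l):]"
proof -
  have d: "degree ([:- 1, 0, 1:] ^ l :: real poly) = 2 * l"
    by (simp add: degree_power_eq)
  have m: "coeff ([:- 1, 0, 1:] ^ l :: real poly) (2 * l) = 1"
    using lead_coeff_power[of "[:- 1, 0, 1:] :: real poly" l] d by simp
  have "(pderiv ^^ (l + l)) ([:- 1, 0, 1:] ^ l :: real poly) = [:fact (2 * l):]"
  proof (rule poly_eqI)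
    fix n
    show "coeff ((pderiv ^^ (l + l)) ([:- 1, 0, 1:] ^ l :: real poly)) n = coeff [:fact (2 * l):] n"
    proof (cases n)
      case 0
      then show ?thesis using m
        by (simp add: coeff_higher_pderiv pochhammer_fact[symmetric] mult_2)
    next
      case (Suc k)
      then have "coeff ([:- 1, 0, 1:] ^ l :: real poly) (n + (l + l)) = 0"
        by (intro coeff_eq_0) (simp add: d)
      then show ?thesis using Suc by (simp add: coeff_higher_pderiv)
    qed
  qed
  then show ?thesis
    by (simp add: legendre_def higher_pderiv_smult funpow_add)
qed

text \<open>
Downward induction from \<open>m = l\<close>, where the derivative is a constant and only the integral of
\<open>(1 - x\<^sup>2)\<^sup>l\<close> remains.
\<close>

lemma legendre_norm:
  assumes "m \<le> l"
  shows "zonal_integral ([:1, 0, - 1:] ^ m * (pderiv ^^ m) (legendre l) * (pderiv ^^ m) (legendre l))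
    = 2 / (2 * real l + 1) * (fact (l + m) / fact (l - m))"
  using assms
proof (induction rule: inc_induct)
  case base
  have "zonal_integral ([:1, 0, - 1:] ^ l * [:fact (2 * l) / (2 ^ l * fact l):] * [:fact (2 * l) / (2 ^ l * fact l):])
     = (fact (2 * l) / (2 ^ l * fact l))\<^sup>2 * zonal_integral ([:1, 0, - 1:] ^ l)"
    by (simp add: zonal_integral_smult power2_eq_square)
  also have "\<dots> = 2 * fact (2 * l) * (fact (2 * l) / fact (2 * l + 1))"
    unfolding zonal_integral_weight by (simp add: power_divide power2_eq_square)
  also have "fact (2 * l) / fact (2 * l + 1) = 1 / (2 * real l + 1)"
    by simp
  finally show ?case unfolding legendre_top_deriv by (simp add: mult_2[symmetric])
next
  case (step m)
  have "2 / (2 * real l + 1) * (fact (l + Suc m) / fact (l - Suc m))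
     = (real l + real m + 1) * (real l - real m) * (2 / (2 * real l + 1) * (fact (l + m) / fact (l - m)))"
  proof -
    obtain d where "l = Suc (m + d)" using step by (auto dest: less_imp_Suc_add)
    then have "fact (l - m) = (real l - real m) * fact (l - Suc m)" by simp
    moreover have "fact (l + Suc m) = (real l + real m + 1) * fact (l + m)" by simp
    ultimately show ?thesis using step by (simp del: fact_Suc add: divide_simps)
  qed
  with step.IH have "(real l + real m + 1) * (real l - real m) *
      zonal_integral ([:1, 0, - 1:] ^ m * (pderiv ^^ m) (legendre l) * (pderiv ^^ m) (legendre l))
    = (real l + real m + 1) * (real l - real m) * (2 / (2 * real l + 1) * (fact (l + m) / fact (l - m)))"
    unfolding legendre_integral_step by simp
  moreover have "(real l + real m + 1) * (real l - real m) \<noteq> 0" using step by (simp add: add_eq_0_iff)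
  ultimately show ?case by (metis mult_left_cancel)
qed

section \<open>Orthonormality of the spherical harmonics\<close>

definition azimuth :: "int \<Rightarrow> real \<Rightarrow> real" where
  "azimuth m \<phi> = (if m = 0 then 1 else if m > 0 then sqrt 2 * cos (m * \<phi>) else sqrt 2 * sin (\<bar>m\<bar> * \<phi>))"

lemma continuous_on_azimuth [continuous_intros]: "continuous_on S (azimuth m)"
  unfolding azimuth_def by (cases "m = 0"; cases "m > 0") (simp_all, (intro continuous_intros)+)

lemma integral_cos_period:
  "(\<integral>\<phi>. indicator {0..2 * pi} \<phi> *\<^sub>R cos (real_of_int n * \<phi>) \<partial>lborel) = (if n = 0 then 2 * pi else 0)"
proof (cases "n = 0")
  case False
  have "(\<integral>\<phi>. indicator {0..2 * pi} \<phi> *\<^sub>R cos (real_of_int n * \<phi>) \<partial>lborel)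
     = sin (real_of_int n * (2 * pi)) / n - sin (real_of_int n * 0) / n"
  proof (rule integral_FTC_atLeastAtMost)
    show "((\<lambda>\<phi>. sin (real_of_int n * \<phi>) / n) has_vector_derivative cos (real_of_int n * x)) (at x within {0..2 * pi})" for x
      unfolding has_real_derivative_iff_has_vector_derivative[symmetric]
      by (rule derivative_eq_intros refl | use False in simp)+
  qed (auto intro!: continuous_intros)
  also have "sin (real_of_int n * (2 * pi)) = 0"
    using sin_int_2pin[of n] by (simp add: mult_ac)
  finally show ?thesis using False by simp
qed simp

lemma integral_sin_period:
  "(\<integral>\<phi>. indicator {0..2 * pi} \<phi> *\<^sub>R sin (real_of_int n * \<phi>) \<partial>lborel) = 0"
proof (cases "n = 0")
  case False
  have "(\<integral>\<phi>. indicator {0..2 * pi} \<phi> *\<^sub>R sin (real_of_int n * \<phi>) \<partial>lborel)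
     = - cos (real_of_int n * (2 * pi)) / n - (- cos (real_of_int n * 0) / n)"
  proof (rule integral_FTC_atLeastAtMost)
    show "((\<lambda>\<phi>. - cos (real_of_int n * \<phi>) / n) has_vector_derivative sin (real_of_int n * x)) (at x within {0..2 * pi})" for x
      unfolding has_real_derivative_iff_has_vector_derivative[symmetric]
      by (rule derivative_eq_intros refl | use False in simp)+
  qed (auto intro!: continuous_intros)
  also have "cos (real_of_int n * (2 * pi)) = 1"
    using cos_int_2pin[of n] by (simp add: mult_ac)
  finally show ?thesis using False by simp
qed simp

lemma azimuth_orthogonal:
  "(\<integral>\<phi>. indicator {0..2 * pi} \<phi> *\<^sub>R (azimuth m \<phi> * azimuth n \<phi>) \<partial>lborel) = (if m = n then 2 * pi else 0)"
proof -
  \<comment> \<open>The product formulas for sine and cosine turn the product into two pure frequencies.\<close>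
  define J where "J f = (\<integral>\<phi>. indicator {0..2 * pi} \<phi> *\<^sub>R f \<phi> \<partial>lborel)" for f :: "real \<Rightarrow> real"
  have int: "integrable lborel (\<lambda>\<phi>. indicator {0..2 * pi} \<phi> *\<^sub>R f \<phi>)" if "continuous_on UNIV f" for f :: "real \<Rightarrow> real"
    using borel_integrable_atLeastAtMost'[of 0 "2 * pi" f] continuous_on_subset[OF that]
    unfolding set_integrable_def by simp
  have add: "J (\<lambda>x. a * f x + b * g x) = a * J f + b * J g"
    if "continuous_on UNIV f" "continuous_on UNIV g" for a b f g
  proof -
    have "J (\<lambda>x. a * f x + b * g x)
      = (\<integral>\<phi>. a * (indicator {0..2 * pi} \<phi> *\<^sub>R f \<phi>) + b * (indicator {0..2 * pi} \<phi> *\<^sub>R g \<phi>) \<partial>lborel)"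
      unfolding J_def by (simp add: algebra_simps)
    also have "\<dots> = a * J f + b * J g" unfolding J_def
      by (subst Bochner_Integration.integral_add)
         (use int[OF that(1)] int[OF that(2)] in simp_all)
    finally show ?thesis .
  qed
  define c s where "c k = (\<lambda>x. cos (real_of_int k * x))" and "s k = (\<lambda>x. sin (real_of_int k * x))" for k
  have cont: "continuous_on UNIV (c k)" "continuous_on UNIV (s k)" for k
    unfolding c_def s_def by (intro continuous_intros)+
  have Jc: "J (c k) = (if k = 0 then 2 * pi else 0)" and Js: "J (s k) = 0" for k
    unfolding J_def c_def s_def by (rule integral_cos_period integral_sin_period)+
  have prod: "sqrt 2 * c k x * (sqrt 2 * c j x) = 1 * c (k - j) x + 1 * c (k + j) x"
    "sqrt 2 * s k x * (sqrt 2 * s j x) = 1 * c (k - j) x + (- 1) * c (k + j) x"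
    "sqrt 2 * s k x * (sqrt 2 * c j x) = 1 * s (k + j) x + 1 * s (k - j) x"
    "sqrt 2 * c j x * (sqrt 2 * s k x) = 1 * s (k + j) x + 1 * s (k - j) x" for k j x
  proof -
    have r: "sqrt 2 * a * (sqrt 2 * b) = 2 * (a * b)" for a b :: real
      using real_sqrt_mult_self[of 2] by (simp add: algebra_simps)
    show "sqrt 2 * c k x * (sqrt 2 * c j x) = 1 * c (k - j) x + 1 * c (k + j) x"
      "sqrt 2 * s k x * (sqrt 2 * s j x) = 1 * c (k - j) x + (- 1) * c (k + j) x"
      "sqrt 2 * s k x * (sqrt 2 * c j x) = 1 * s (k + j) x + 1 * s (k - j) x"
      "sqrt 2 * c j x * (sqrt 2 * s k x) = 1 * s (k + j) x + 1 * s (k - j) x"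
      unfolding r c_def s_def by (simp_all add: cos_add cos_diff sin_add sin_diff algebra_simps)
  qed
  have az: "azimuth k x = (if k = 0 then c 0 x else if k > 0 then sqrt 2 * c k x else sqrt 2 * s \<bar>k\<bar> x)" for k x
    by (simp add: azimuth_def c_def s_def)
  have one: "c 0 x * f = 1 * f + 0 * f" "f * c 0 x = 1 * f + 0 * f" for f x by (simp_all add: c_def)
  have sq: "J (\<lambda>x. sqrt 2 * f x) = sqrt 2 * J f" for f
    unfolding J_def by (subst integral_mult_right_zero[symmetric]) (simp add: algebra_simps)
  have "J (\<lambda>x. azimuth m x * azimuth n x) = (if m = n then 2 * pi else 0)"
  proof (cases "m = 0 \<or> n = 0")
    case True
    have "J (\<lambda>x. 1) = 2 * pi" using Jc[of 0] by (simp add: c_def)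
    with True show ?thesis
      unfolding az by (cases "m > 0"; cases "n > 0") (auto simp: c_def[of 0] sq Jc Js)
  next
    case False
    have "J (\<lambda>x. azimuth m x * azimuth n x) = (if m = n then 2 * pi else 0)" if "m < 0" "n < 0"
    proof -
      have "(\<lambda>x. azimuth m x * azimuth n x) = (\<lambda>x. 1 * c (\<bar>m\<bar> - \<bar>n\<bar>) x + (- 1) * c (\<bar>m\<bar> + \<bar>n\<bar>) x)"
        using that prod(2)[of "\<bar>m\<bar>" _ "\<bar>n\<bar>"] by (simp add: az fun_eq_iff)
      then show ?thesis using that by (simp only: add[OF cont(1) cont(1)] Jc) auto
    qed
    moreover have "J (\<lambda>x. azimuth m x * azimuth n x) = (if m = n then 2 * pi else 0)" if "m > 0" "n > 0"
    proof -
      have "(\<lambda>x. azimuth m x * azimuth n x) = (\<lambda>x. 1 * c (m - n) x + 1 * c (m + n) x)"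
        using that prod(1)[of m _ n] by (simp add: az fun_eq_iff)
      then show ?thesis using that by (simp only: add[OF cont(1) cont(1)] Jc) auto
    qed
    moreover have "J (\<lambda>x. azimuth m x * azimuth n x) = (if m = n then 2 * pi else 0)" if "m < 0" "n > 0"
    proof -
      have "(\<lambda>x. azimuth m x * azimuth n x) = (\<lambda>x. 1 * s (\<bar>m\<bar> + n) x + 1 * s (\<bar>m\<bar> - n) x)"
        using that prod(3)[of "\<bar>m\<bar>" _ n] by (simp add: az fun_eq_iff)
      then show ?thesis using that by (simp only: add[OF cont(2) cont(2)] Js) auto
    qed
    moreover have "J (\<lambda>x. azimuth m x * azimuth n x) = (if m = n then 2 * pi else 0)" if "m > 0" "n < 0"
    proof -
      have "(\<lambda>x. azimuth m x * azimuth n x) = (\<lambda>x. 1 * s (\<bar>n\<bar> + m) x + 1 * s (\<bar>n\<bar> - m) x)"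
        using that prod(4)[of m _ "\<bar>n\<bar>"] by (simp add: az fun_eq_iff)
      then show ?thesis using that by (simp only: add[OF cont(2) cont(2)] Js) auto
    qed
    ultimately show ?thesis using False by (metis not_less_iff_gr_or_eq)
  qed
  then show ?thesis unfolding J_def .
qed

lemma integral_pair_product:
  fixes f g :: "real \<Rightarrow> real"
  assumes f: "integrable lborel f" and g: "integrable lborel g"
  shows "(\<integral>p. f (fst p) * g (snd p) \<partial>lborel) = (\<integral>x. f x \<partial>lborel) * (\<integral>y. g y \<partial>lborel)"
proof -
  have [measurable]: "f \<in> borel_measurable borel" "g \<in> borel_measurable borel"
    using f g by (auto dest: borel_measurable_integrable)
  have "integrable (lborel \<Otimes>\<^sub>M lborel) (\<lambda>p. f (fst p) * g (snd p))"
    by (rule lborel_pair.Fubini_integrable) (use f g in \<open>auto simp: abs_mult\<close>)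
  from lborel_pair.integral_fst'[OF this]
  show ?thesis by (simp add: lborel_prod)
qed

lemma sphere_integral_product:
  assumes F: "F \<in> borel_measurable (restrict_space borel (sphere 0 1))"
    and a: "integrable lborel (\<lambda>\<theta>. indicator {0..pi} \<theta> *\<^sub>R (a \<theta> * sin \<theta>))"
    and b: "integrable lborel (\<lambda>\<phi>. indicator {0..2 * pi} \<phi> *\<^sub>R b \<phi>)"
    and prod: "\<And>\<theta> \<phi>. 0 \<le> \<theta> \<Longrightarrow> \<theta> \<le> pi \<Longrightarrow> F (sphere_coord (\<theta>, \<phi>)) = a \<theta> * b \<phi>"
  shows "(\<integral>x. F x \<partial>sphere_measure) = (\<integral>\<theta>. indicator {0..pi} \<theta> *\<^sub>R (a \<theta> * sin \<theta>) \<partial>lborel)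
     * (\<integral>\<phi>. indicator {0..2 * pi} \<phi> *\<^sub>R b \<phi> \<partial>lborel)"
proof -
  let ?Q = "{0..pi} \<times> {0..2 * pi}"
  let ?N = "restrict_space lborel ?Q"
  have Q: "?Q \<inter> space lborel \<in> sets lborel"
    by (simp add: borel_closed closed_Times)
  have meas: "(\<lambda>p. F (sphere_coord p)) \<in> borel_measurable ?N"
    using measurable_compose[OF measurable_sphere_coord F] by simp
  have s: "(\<lambda>(\<theta>::real, \<phi>::real). ennreal (sin \<theta>)) = (\<lambda>p. ennreal (sin (fst p)))"
    by auto
  have ms: "(\<lambda>p. sin (fst p)) \<in> borel_measurable ?N"
    by (intro measurable_restrict_space1) (auto intro!: borel_measurable_continuous_onI continuous_intros)
  have "(\<integral>x. F x \<partial>sphere_measure) = (\<integral>p. F (sphere_coord p) \<partial>density ?N (\<lambda>p. ennreal (sin (fst p))))"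
    unfolding sphere_measure_def using integral_distr[OF measurable_sphere_coord F] by (simp add: s)
  also have "\<dots> = (\<integral>p. sin (fst p) *\<^sub>R F (sphere_coord p) \<partial>?N)"
    using meas ms by (intro integral_density) (auto intro!: AE_I2 sin_ge_zero simp: space_restrict_space)
  also have "\<dots> = (\<integral>p. indicator ?Q p *\<^sub>R (sin (fst p) *\<^sub>R F (sphere_coord p)) \<partial>lborel)"
    using Q by (rule integral_restrict_space)
  also have "\<dots> = (\<integral>p. (indicator {0..pi} (fst p) *\<^sub>R (a (fst p) * sin (fst p))) * (indicator {0..2 * pi} (snd p) *\<^sub>R b (snd p)) \<partial>lborel)"
    by (intro Bochner_Integration.integral_cong refl)
       (auto simp: indicator_def prod split: prod.splits)
  also have "\<dots> = (\<integral>\<theta>. indicator {0..pi} \<theta> *\<^sub>R (a \<theta> * sin \<theta>) \<partial>lborel)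
     * (\<integral>\<phi>. indicator {0..2 * pi} \<phi> *\<^sub>R b \<phi> \<partial>lborel)"
    using a b by (rule integral_pair_product)
  finally show ?thesis .
qed

text \<open>
In spherical coordinates each harmonic is a function of \<open>\<theta>\<close> times one of \<open>\<phi>\<close>. Different orders are
separated by the azimuthal factor, equal orders and different degrees by the Legendre factor, and
\<open>harm_const\<close> normalises the product of the two norms.
\<close>

lemma harm_orthonormal:
  assumes "\<bar>m\<bar> \<le> int l" "\<bar>m'\<bar> \<le> int l'"
  shows "inner (harm l m) (harm l' m') = (if l = l' \<and> m = m' then 1 else 0)"
proof -
  define k k' where "k = nat \<bar>m\<bar>" and "k' = nat \<bar>m'\<bar>"
  define a where "a = (\<lambda>\<theta>. harm_const l k * harm_const l' k' * (assoc_legendre l k (cos \<theta>) * assoc_legendre l' k' (cos \<theta>)))"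
  define b where "b = (\<lambda>\<phi>. azimuth m \<phi> * azimuth m' \<phi>)"
  have F: "(\<lambda>x. harm_fun l m x * harm_fun l' m' x) \<in> borel_measurable (restrict_space borel (sphere 0 1))"
    by (intro borel_measurable_continuous_on_restrict continuous_intros continuous_on_subset[OF continuous_on_harm_fun] subset_UNIV)
  have cont: "continuous_on {0..pi} (\<lambda>\<theta>. a \<theta> * sin \<theta>)"
    unfolding a_def assoc_legendre_def by (intro continuous_intros)
  have h: "harm_fun l m (sphere_coord (\<theta>, \<phi>)) = harm_const l (nat \<bar>m\<bar>) * assoc_legendre l (nat \<bar>m\<bar>) (cos \<theta>) * azimuth m \<phi>"
    if "0 \<le> \<theta>" "\<theta> \<le> pi" for l m \<theta> \<phi>
    using harm_fun_sphere_coord[OF that] by (simp add: azimuth_def)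
  have "inner (harm l m) (harm l' m') = (\<integral>x. harm_fun l m x * harm_fun l' m' x \<partial>sphere_measure)"
    by transfer simp
  also have "\<dots> = (\<integral>\<theta>. indicator {0..pi} \<theta> *\<^sub>R (a \<theta> * sin \<theta>) \<partial>lborel)
     * (\<integral>\<phi>. indicator {0..2 * pi} \<phi> *\<^sub>R b \<phi> \<partial>lborel)"
  proof (rule sphere_integral_product[OF F])
    show "integrable lborel (\<lambda>\<theta>. indicator {0..pi} \<theta> *\<^sub>R (a \<theta> * sin \<theta>))"
      using borel_integrable_atLeastAtMost'[OF cont] by (simp add: set_integrable_def)
    show "integrable lborel (\<lambda>\<phi>. indicator {0..2 * pi} \<phi> *\<^sub>R b \<phi>)"
      using borel_integrable_atLeastAtMost'[of 0 "2 * pi" b]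
      by (simp add: set_integrable_def b_def continuous_intros)
    show "harm_fun l m (sphere_coord (\<theta>, \<phi>)) * harm_fun l' m' (sphere_coord (\<theta>, \<phi>)) = a \<theta> * b \<phi>"
      if "0 \<le> \<theta>" "\<theta> \<le> pi" for \<theta> \<phi>
      using h[OF that] by (simp add: a_def b_def k_def k'_def)
  qed
  also have "\<dots> = (if l = l' \<and> m = m' then 1 else 0)"
  proof (cases "m = m'")
    case False
    then show ?thesis by (simp add: b_def azimuth_orthogonal del: real_scaleR_def)
  next
    case True
    define P where "P = [:1, 0, - 1:] ^ k * (pderiv ^^ k) (legendre l) * (pderiv ^^ k) (legendre l')"
    have kk: "k' = k" using True by (simp add: k_def k'_def)
    have "a \<theta> = poly (smult (harm_const l k * harm_const l' k) P) (cos \<theta>)" for \<theta>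
    proof -
      have "(sqrt (1 - (cos \<theta>)\<^sup>2) ^ k) * (sqrt (1 - (cos \<theta>)\<^sup>2) ^ k) = (1 - (cos \<theta>)\<^sup>2) ^ k"
        by (simp add: power_mult_distrib[symmetric] abs_square_le_1)
      moreover have "(- 1 :: real) ^ k * (- 1) ^ k = 1" by (simp add: power_mult_distrib[symmetric])
      ultimately show ?thesis unfolding a_def assoc_legendre_def kk P_def
        by (simp add: algebra_simps power2_eq_square)
    qed
    then have a: "a \<theta> = poly (smult (harm_const l k * harm_const l' k) P) (cos \<theta>)" for \<theta> .
    have "(\<integral>\<theta>. indicator {0..pi} \<theta> *\<^sub>R (a \<theta> * sin \<theta>) \<partial>lborel) = harm_const l k * harm_const l' k * zonal_integral P"
      unfolding a using zonal_integral_smult[of "harm_const l k * harm_const l' k" P]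
      unfolding zonal_integral_def .
    moreover have "harm_const l k * harm_const l k * (2 / (2 * real l + 1) * (fact (l + k) / fact (l - k))) = 1 / (2 * pi)"
      by (simp add: harm_const_def divide_simps)
    moreover have "k \<le> l" using assms by (simp add: k_def)
    ultimately show ?thesis
      using True by (cases "l = l'") (simp_all add: b_def azimuth_orthogonal P_def legendre_orthogonal legendre_norm del: real_scaleR_def)
  qed
  finally show ?thesis .
qed

text \<open>
The remainder of \<open>f\<close> after subtracting its projection on the span has nonnegative norm.
\<close>

lemma bessel_finite:
  fixes e :: "'i \<Rightarrow> 'a::real_inner"
  assumes "finite A" and orth: "\<And>i j. i \<in> A \<Longrightarrow> j \<in> A \<Longrightarrow> inner (e i) (e j) = (if i = j then 1 else 0)"
  shows "(\<Sum>i\<in>A. (inner f (e i))\<^sup>2) \<le> (norm f)\<^sup>2"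
proof -
  define p where "p = (\<Sum>i\<in>A. inner f (e i) *\<^sub>R e i)"
  have fp: "inner f p = (\<Sum>i\<in>A. (inner f (e i))\<^sup>2)"
    by (simp add: p_def inner_sum_right power2_eq_square)
  have "inner (e j) p = inner f (e j)" if "j \<in> A" for j
  proof -
    have "inner (e j) p = (\<Sum>i\<in>A. if j = i then inner f (e i) else 0)"
      unfolding p_def inner_sum_right by (intro sum.cong) (auto simp: orth that)
    then show ?thesis using \<open>finite A\<close> that by simp
  qed
  then have "inner p p = inner f p"
    unfolding fp by (subst p_def) (simp add: inner_sum_left power2_eq_square)
  then have "0 \<le> inner f f - inner f p"
    using inner_ge_zero[of "f - p"] by (simp add: inner_diff inner_commute)
  then show ?thesis by (simp add: fp power2_norm_eq_inner)
qed

lemma bessel_harm: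
  "(\<Sum>l\<le>N. \<Sum>m = - int l..int l. (inner f (harm l m))\<^sup>2) \<le> (norm f)\<^sup>2"
proof -
  have "(\<Sum>l\<le>N. \<Sum>m = - int l..int l. (inner f (harm l m))\<^sup>2)
    = (\<Sum>i\<in>Sigma {..N} (\<lambda>l. {- int l..int l}). (inner f (case_prod harm i))\<^sup>2)"
    by (simp add: sum.Sigma case_prod_unfold)
  also have "\<dots> \<le> (norm f)\<^sup>2"
    by (rule bessel_finite) (auto simp: harm_orthonormal split: if_splits)
  finally show ?thesis .
qed

section \<open>Sobolev spaces of coefficients\<close>

lemma space_sobolev_borel: "space (sobolev_borel \<eta>) = sobolev \<eta>"
  unfolding sobolev_borel_def by (subst space_measure_of) auto

lemma sobolev_sq_nonneg: "0 \<le> sobolev_sq \<eta> f l"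
  unfolding sobolev_sq_def by (intro sum_nonneg) simp

lemma sobolev_coeff_le:
  assumes "f \<in> sobolev \<eta>" "\<bar>m\<bar> \<le> int l"
  shows "(1 + real l * (real l + 1)) powr \<eta> * (f l m)\<^sup>2 \<le> (sobolev_norm \<eta> f)\<^sup>2"
proof -
  note nn = sobolev_sq_nonneg[of \<eta> f]
  have "(1 + real l * (real l + 1)) powr \<eta> * (f l m)\<^sup>2 \<le> sobolev_sq \<eta> f l"
    unfolding sobolev_sq_def using assms(2) by (intro member_le_sum) auto
  also have "\<dots> \<le> (\<Sum>k. sobolev_sq \<eta> f k)"
    using assms nn by (intro sum_le_suminf[of _ "{l}", simplified]) (auto simp: sobolev_def)
  also have "\<dots> = (sobolev_norm \<eta> f)\<^sup>2"
    unfolding sobolev_norm_def using assms nn by (simp add: suminf_nonneg sobolev_def)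
  finally show ?thesis .
qed

lemma sobolev_norm_nonneg:
  assumes "f \<in> sobolev \<eta>"
  shows "0 \<le> sobolev_norm \<eta> f"
  using assms unfolding sobolev_norm_def
  by (auto intro!: suminf_nonneg sum_nonneg simp: sobolev_def sobolev_sq_def)

lemma weighted_sq_diff_le: "w * (a - b)\<^sup>2 \<le> 2 * (w * a\<^sup>2) + 2 * (w * b\<^sup>2)" if "0 \<le> w" for w a b :: real
proof -
  have "(a - b)\<^sup>2 \<le> 2 * a\<^sup>2 + 2 * b\<^sup>2" using zero_le_power2[of "a + b"]
    by (simp add: power2_eq_square algebra_simps)
  from mult_left_mono[OF this that] show ?thesis by (simp add: algebra_simps)
qed

lemma sobolev_diff:
  assumes "f \<in> sobolev \<eta>" "g \<in> sobolev \<eta>"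
  shows "(\<lambda>l m. f l m - g l m) \<in> sobolev \<eta>"
proof -
  let ?d = "\<lambda>l m. f l m - g l m"
  have le: "sobolev_sq \<eta> ?d l \<le> 2 * sobolev_sq \<eta> f l + 2 * sobolev_sq \<eta> g l" for l
    unfolding sobolev_sq_def sum_distrib_left sum.distrib[symmetric]
    by (intro sum_mono weighted_sq_diff_le) simp
  note nonneg = sobolev_sq_nonneg[of \<eta> ?d]
  have "summable (\<lambda>l. 2 * sobolev_sq \<eta> f l + 2 * sobolev_sq \<eta> g l)"
    using assms by (intro summable_add summable_mult) (auto simp: sobolev_def)
  then have "summable (sobolev_sq \<eta> ?d)"
    by (rule summable_comparison_test'[where N = 0]) (use le nonneg in simp)
  then show ?thesis using assms by (auto simp: sobolev_def)
qed

text \<open>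
A single coefficient is a continuous functional, since it is controlled by the norm; hence preimages of
open sets are among the generators of the Borel sets.
\<close>

lemma measurable_sobolev_coeff:
  assumes lm: "\<bar>m\<bar> \<le> int l"
  shows "(\<lambda>f. f l m) \<in> borel_measurable (sobolev_borel \<eta>)"
proof (rule borel_measurableI)
  fix U :: "real set" assume U: "open U"
  let ?w = "(1 + real l * (real l + 1)) powr \<eta>"
  have w: "0 < ?w" by (simp add: add_nonneg_eq_0_iff)
  let ?V = "(\<lambda>f. f l m) -` U \<inter> sobolev \<eta>"
  have "\<exists>e>0. \<forall>g\<in>sobolev \<eta>. sobolev_norm \<eta> (\<lambda>l m. g l m - f l m) < e \<longrightarrow> g \<in> ?V" if f: "f \<in> ?V" for f
  proof -
    obtain d where d: "d > 0" "\<And>y. dist y (f l m) < d \<Longrightarrow> y \<in> U"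
      using U f by (auto simp: open_dist)
    have "g \<in> ?V" if g: "g \<in> sobolev \<eta>" "sobolev_norm \<eta> (\<lambda>l m. g l m - f l m) < sqrt ?w * d" for g
    proof -
      have nn: "0 \<le> sobolev_norm \<eta> (\<lambda>l m. g l m - f l m)"
        using sobolev_norm_nonneg[OF sobolev_diff[OF g(1)], of f] f by simp
      have "?w * (g l m - f l m)\<^sup>2 \<le> (sobolev_norm \<eta> (\<lambda>l m. g l m - f l m))\<^sup>2"
        using sobolev_coeff_le[OF sobolev_diff[OF g(1)] lm] f by simp
      also have "\<dots> < (sqrt ?w * d)\<^sup>2" using g(2) nn by (intro power_strict_mono) auto
      also have "\<dots> = ?w * d\<^sup>2" using w by (simp add: power_mult_distrib)
      finally have "(g l m - f l m)\<^sup>2 < d\<^sup>2" using w by simp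
      then have "\<bar>g l m - f l m\<bar> < d" using d(1) by (metis abs_le_square_iff abs_of_pos linorder_not_le)
      then show ?thesis using d(2) g(1) by (simp add: dist_real_def)
    qed
    then show ?thesis using w d(1) by (intro exI[of _ "sqrt ?w * d"]) simp
  qed
  then have "?V \<in> sets (sobolev_borel \<eta>)"
    unfolding sobolev_borel_def by (intro in_measure_of) auto
  then show "(\<lambda>f. f l m) -` U \<inter> space (sobolev_borel \<eta>) \<in> sets (sobolev_borel \<eta>)"
    by (simp only: space_sobolev_borel)
qed

lemma measurable_sobolev_norm: "sobolev_norm \<eta> \<in> borel_measurable (sobolev_borel \<eta>)"
proof -
  have "(\<lambda>f. sobolev_sq \<eta> f l) \<in> borel_measurable (sobolev_borel \<eta>)" for l
    unfolding sobolev_sq_def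
    by (intro borel_measurable_sum borel_measurable_times borel_measurable_power
        borel_measurable_const measurable_sobolev_coeff) auto
  then show ?thesis
    unfolding sobolev_norm_def[abs_def]
    by (intro measurable_compose[OF _ borel_measurable_sqrt] borel_measurable_suminf)
qed

section \<open>Second moments of stochastic convolutions\<close>

text \<open>
Cauchy's functional equation. The difference \<open>g\<close> of \<open>f\<close> and the linear candidate vanishes at the
integers, so it is periodic; a bound near zero then bounds it everywhere, and \<open>g(nt) = n g(t)\<close> forces
it to vanish.
\<close>

lemma additive_bounded_linear:
  fixes f :: "real \<Rightarrow> real"
  assumes add: "\<And>s h. 0 \<le> s \<Longrightarrow> 0 \<le> h \<Longrightarrow> f (s + h) = f s + f h"
    and \<delta>: "0 < \<delta>" and bound: "\<And>t. 0 \<le> t \<Longrightarrow> t \<le> \<delta> \<Longrightarrow> \<bar>f t\<bar> \<le> B"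
    and t: "0 \<le> t"
  shows "f t = t * f 1"
proof -
  define g where "g s = f s - s * f 1" for s
  have g_add: "g (s + h) = g s + g h" if "0 \<le> s" "0 \<le> h" for s h
    using add[OF that] by (simp add: g_def algebra_simps)
  have g_mult: "g (of_nat n * s) = of_nat n * g s" if "0 \<le> s" for n s
  proof (induction n)
    case 0
    show ?case using g_add[of 0 0] by simp
  next
    case (Suc n)
    then show ?case using g_add[of s "of_nat n * s"] that by (simp add: algebra_simps)
  qed
  have g1: "g 1 = 0" by (simp add: g_def)
  obtain N :: nat where N: "1 / \<delta> < N" using reals_Archimedean2 by blast
  then have N0: "0 < N" using \<delta> by (intro gr0I) (auto simp: divide_less_0_iff)
  have N1: "1 / N < \<delta>" using N N0 \<delta> by (simp add: divide_less_eq mult.commute)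
  define D where "D = N * (B + \<delta> * \<bar>f 1\<bar>)"
  have unit: "\<bar>g s\<bar> \<le> D" if "0 \<le> s" "s \<le> 1" for s
  proof -
    have s: "0 \<le> s / N" "s / N \<le> \<delta>"
      using that N0 N1 by (auto intro: order.trans[OF divide_right_mono[of s 1 N]])
    have "\<bar>g (s / N)\<bar> \<le> \<bar>f (s / N)\<bar> + \<bar>s / N * f 1\<bar>" unfolding g_def by (rule abs_triangle_ineq4)
    also have "\<bar>s / N * f 1\<bar> \<le> \<delta> * \<bar>f 1\<bar>"
      unfolding abs_mult abs_of_nonneg[OF s(1)] using s by (intro mult_right_mono) auto
    also have "\<bar>f (s / N)\<bar> \<le> B" using bound[OF s] .
    finally have "real N * \<bar>g (s / N)\<bar> \<le> D" unfolding D_def by (intro mult_left_mono) simp_all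
    then show ?thesis using g_mult[OF s(1), of N] N0 by (simp add: abs_mult)
  qed
  have all: "\<bar>g s\<bar> \<le> D" if "0 \<le> s" for s
  proof -
    define n where "n = nat \<lfloor>s\<rfloor>"
    have n: "real n \<le> s" "s \<le> real n + 1" using that unfolding n_def by linarith+
    then have "g s = g (real n * 1) + g (s - n)" using g_add[of "real n" "s - n"] by simp
    also have "g (real n * 1) = 0" using g_mult[of 1 n] g1 by simp
    finally show ?thesis using unit[of "s - n"] n by simp
  qed
  have "g t = 0"
  proof (rule ccontr)
    assume "g t \<noteq> 0"
    then obtain n :: nat where n: "D / \<bar>g t\<bar> < n" using reals_Archimedean2 by blast
    then have "D < real n * \<bar>g t\<bar>" using \<open>g t \<noteq> 0\<close> by (simp add: field_simps)
    moreover have "real n * \<bar>g t\<bar> \<le> D" using all[of "real n * t"] t by (simp add: g_mult abs_mult)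
    ultimately show False by simp
  qed
  then show ?thesis by (simp add: g_def)
qed

text \<open>
The intervals of the partition are disjoint, so the square of the step function is the step function of
the squares.
\<close>

lemma step_fun_sq_integral_ge:
  assumes p: "p 0 = 0" "\<And>i. i < n \<Longrightarrow> p i < p (Suc i)"
  shows "ennreal (\<Sum>i<n. (c i)\<^sup>2 * (p (Suc i) - p i))
    \<le> (\<integral>\<^sup>+s\<in>{0..p n}. ennreal ((step_fun n p c s)\<^sup>2) \<partial>lborel)"
proof -
  have mono: "p i \<le> p j" if "i \<le> j" "j \<le> n" for i j
    using that
  proof (induction j)
    case (Suc j)
    then show ?case using p(2)[of j] by (cases "i = Suc j") auto
  qed simp
  have "ennreal (\<Sum>i<n. (c i)\<^sup>2 * (p (Suc i) - p i))
     = (\<Sum>i<n. ennreal ((c i)\<^sup>2) * emeasure lborel {p i<..p (Suc i)})"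
    using p(2) by (subst sum_ennreal[symmetric]) (auto simp: less_imp_le ennreal_mult intro!: sum.cong)
  also have "\<dots> = (\<integral>\<^sup>+s. (\<Sum>i<n. ennreal ((c i)\<^sup>2) * indicator {p i<..p (Suc i)} s) \<partial>lborel)"
    by (subst nn_integral_sum) (auto simp: nn_integral_cmult_indicator)
  also have "\<dots> \<le> (\<integral>\<^sup>+s\<in>{0..p n}. ennreal ((step_fun n p c s)\<^sup>2) \<partial>lborel)"
  proof (rule nn_integral_mono)
    fix s
    show "(\<Sum>i<n. ennreal ((c i)\<^sup>2) * indicator {p i<..p (Suc i)} s)
      \<le> ennreal ((step_fun n p c s)\<^sup>2) * indicator {0..p n} s"
    proof (cases "\<exists>j<n. s \<in> {p j<..p (Suc j)}")
      case True
      then obtain j where j: "j < n" "p j < s" "s \<le> p (Suc j)" by auto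
      have ne: "s \<notin> {p i<..p (Suc i)}" if "i < n" "i \<noteq> j" for i
      proof (cases "i < j")
        case True
        then show ?thesis using mono[of "Suc i" j] j by auto
      next
        case False
        then show ?thesis using mono[of "Suc j" i] j that by auto
      qed
      have "step_fun n p c s = (\<Sum>i<n. if i = j then c j else 0)"
        unfolding step_fun_def using j ne by (intro sum.cong) auto
      moreover have "(\<Sum>i<n. ennreal ((c i)\<^sup>2) * indicator {p i<..p (Suc i)} s)
         = (\<Sum>i<n. if i = j then ennreal ((c j)\<^sup>2) else 0)"
        using j ne by (intro sum.cong) auto
      moreover have "s \<in> {0..p n}" using mono[of 0 j] mono[of "Suc j" n] j p(1) by auto
      ultimately show ?thesis using j by simp
    next
      case False
      then have "(\<Sum>i<n. ennreal ((c i)\<^sup>2) * indicator {p i<..p (Suc i)} s) = 0"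
        by (intro sum.neutral) auto
      then show ?thesis by simp
    qed
  qed
  finally show ?thesis .
qed

locale levy_L2 = prob_space M for M :: "'w measure" +
  fixes \<eta> :: real and L :: "real \<Rightarrow> 'w \<Rightarrow> coeffs"
  assumes levy: "levy_process M (sobolev_borel \<eta>) (sobolev_norm \<eta>) L"
    and L2: "\<And>t. 0 \<le> t \<Longrightarrow> L t \<in> L2_sobolev M \<eta>"
begin

lemma levy_indep:
  assumes "0 \<le> p 0" "\<And>i. i < n \<Longrightarrow> p i < p (Suc i)"
  shows "indep_vars (\<lambda>_. sobolev_borel \<eta>) (\<lambda>i \<omega>. L (p (Suc i)) \<omega> - L (p i) \<omega>) {..<n}"
  using levy assms unfolding levy_process_def by blast

lemma levy_stationary:
  assumes "0 \<le> s" "0 \<le> h"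
  shows "distr M (sobolev_borel \<eta>) (\<lambda>\<omega>. L (s + h) \<omega> - L s \<omega>) = distr M (sobolev_borel \<eta>) (L h)"
  using levy assms unfolding levy_process_def by blast

lemma increment_measurable:
  assumes "0 \<le> s" "s < t"
  shows "(\<lambda>\<omega>. L t \<omega> - L s \<omega>) \<in> M \<rightarrow>\<^sub>M sobolev_borel \<eta>"
proof -
  define p :: "nat \<Rightarrow> real" where "p i = (if i = 0 then s else t)" for i
  have "indep_vars (\<lambda>_. sobolev_borel \<eta>) (\<lambda>i \<omega>. L (p (Suc i)) \<omega> - L (p i) \<omega>) {..<Suc 0}"
    by (rule levy_indep) (use assms in \<open>auto simp: p_def\<close>)
  then show ?thesis unfolding indep_vars_def by (simp add: p_def)
qed

lemma coeff_measurable: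
  assumes "0 \<le> t" "\<bar>m\<bar> \<le> int l"
  shows "(\<lambda>\<omega>. L t \<omega> l m) \<in> borel_measurable M"
  using measurable_compose[OF _ measurable_sobolev_coeff[OF assms(2)]] L2[OF assms(1)]
  by (auto simp: L2_sobolev_def)

lemma coeff_sq_integrable:
  assumes "0 \<le> t" "\<bar>m\<bar> \<le> int l"
  shows "integrable M (\<lambda>\<omega>. (L t \<omega> l m)\<^sup>2)"
proof -
  let ?w = "(1 + real l * (real l + 1)) powr \<eta>"
  have w: "0 < ?w" by (simp add: add_nonneg_eq_0_iff)
  have meas: "L t \<in> M \<rightarrow>\<^sub>M sobolev_borel \<eta>" and int: "integrable M (\<lambda>\<omega>. (sobolev_norm \<eta> (L t \<omega>))\<^sup>2 / ?w)"
    using L2[OF assms(1)] by (auto simp: L2_sobolev_def)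
  show ?thesis
  proof (rule Bochner_Integration.integrable_bound[OF int])
    show "(\<lambda>\<omega>. (L t \<omega> l m)\<^sup>2) \<in> borel_measurable M" using coeff_measurable[OF assms] by simp
    have "(L t \<omega> l m)\<^sup>2 \<le> (sobolev_norm \<eta> (L t \<omega>))\<^sup>2 / ?w" if "\<omega> \<in> space M" for \<omega>
      using sobolev_coeff_le[OF _ assms(2), of "L t \<omega>" \<eta>] measurable_space[OF meas that] w
      by (simp add: space_sobolev_borel field_simps)
    then show "AE \<omega> in M. norm ((L t \<omega> l m)\<^sup>2) \<le> norm ((sobolev_norm \<eta> (L t \<omega>))\<^sup>2 / ?w)"
      by (auto intro!: AE_I2)
  qed
qed

end

text \<open>
A single coefficient of the process is a real square-integrable Levy process. Its mean and variance at
time \<open>t\<close> are shown to be \<open>t\<close> times their values at time \<open>1\<close>.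
\<close>

locale levy_mode = levy_L2 M \<eta> L for M :: "'w measure" and \<eta> L +
  fixes l :: nat and m :: int
  assumes lm: "\<bar>m\<bar> \<le> int l"
begin

definition mode :: "real \<Rightarrow> 'w \<Rightarrow> real" where
  "mode t \<omega> = L t \<omega> l m"

definition mode_mean :: "real \<Rightarrow> real" where
  "mode_mean t = expectation (mode t)"

definition mode_var :: "real \<Rightarrow> real" where
  "mode_var t = variance (mode t)"

lemma mode_meas: "0 \<le> t \<Longrightarrow> mode t \<in> borel_measurable M"
  using coeff_measurable[OF _ lm] unfolding mode_def by simp

lemma mode_sq: "0 \<le> t \<Longrightarrow> integrable M (\<lambda>\<omega>. (mode t \<omega>)\<^sup>2)"
  using coeff_sq_integrable[OF _ lm] unfolding mode_def by simp

lemma mode_int: "0 \<le> t \<Longrightarrow> integrable M (mode t)"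
  using square_integrable_imp_integrable mode_meas mode_sq by blast

lemma increments_indep:
  assumes "0 \<le> p 0" "\<And>i. i < n \<Longrightarrow> p i < p (Suc i)"
  shows "indep_vars (\<lambda>_. borel) (\<lambda>i \<omega>. mode (p (Suc i)) \<omega> - mode (p i) \<omega>) {..<n}"
proof -
  have "indep_vars (\<lambda>_. sobolev_borel \<eta>) (\<lambda>i \<omega>. L (p (Suc i)) \<omega> - L (p i) \<omega>) {..<n}"
    using assms by (rule levy_indep)
  from indep_vars_compose2[OF this, of "\<lambda>_ f. f l m" "\<lambda>_. borel"] measurable_sobolev_coeff[OF lm]
  show ?thesis by (simp add: mode_def)
qed

lemma increment_distr:
  assumes "0 \<le> s" "s < t" "g \<in> borel_measurable borel"
  shows "expectation (\<lambda>\<omega>. g (mode t \<omega> - mode s \<omega>)) = (expectation (\<lambda>\<omega>. g (mode (t - s) \<omega>)) :: real)"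
proof -
  let ?B = "sobolev_borel \<eta>"
  have m1: "(\<lambda>\<omega>. L t \<omega> - L s \<omega>) \<in> M \<rightarrow>\<^sub>M ?B"
    using increment_measurable assms by simp
  have m2: "L (t - s) \<in> M \<rightarrow>\<^sub>M ?B" using L2[of "t - s"] assms by (auto simp: L2_sobolev_def)
  have "distr M ?B (\<lambda>\<omega>. L (s + (t - s)) \<omega> - L s \<omega>) = distr M ?B (L (t - s))"
    by (rule levy_stationary) (use assms in auto)
  then have d: "distr M ?B (\<lambda>\<omega>. L t \<omega> - L s \<omega>) = distr M ?B (L (t - s))" by simp
  have g: "(\<lambda>f. g (f l m)) \<in> borel_measurable ?B"
    using measurable_compose[OF measurable_sobolev_coeff[OF lm] assms(3)] .
  show ?thesis
    using integral_distr[OF m1 g] integral_distr[OF m2 g] d by (simp add: mode_def)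
qed

lemma mode_0: "AE \<omega> in M. mode 0 \<omega> = 0"
proof -
  have "AE \<omega> in M. L 0 \<omega> = 0" using levy unfolding levy_process_def by blast
  then show ?thesis by eventually_elim (simp add: mode_def)
qed

lemma mode_mean_0: "mode_mean 0 = 0" and mode_var_0: "mode_var 0 = 0"
proof -
  note z = mode_0
  have "mode_mean 0 = expectation (\<lambda>_. 0)" unfolding mode_mean_def
    by (intro integral_cong_AE mode_meas) (use z in auto)
  then show m: "mode_mean 0 = 0" by simp
  have "mode_var 0 = expectation (\<lambda>_. 0)" unfolding mode_mean_def[symmetric] mode_var_def m
    by (intro integral_cong_AE borel_measurable_power borel_measurable_diff mode_meas) (use z in auto)
  then show "mode_var 0 = 0" by simp
qed

lemma increment_mean:
  assumes "0 \<le> s" "s < t"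
  shows "expectation (\<lambda>\<omega>. mode t \<omega> - mode s \<omega>) = mode_mean (t - s)"
  using increment_distr[OF assms, of "\<lambda>x. x"] by (simp add: mode_mean_def)

lemma increment_var:
  assumes "0 \<le> s" "s < t"
  shows "variance (\<lambda>\<omega>. mode t \<omega> - mode s \<omega>) = mode_var (t - s)"
  unfolding increment_mean[OF assms]
  using increment_distr[OF assms, of "\<lambda>x. (x - mode_mean (t - s))\<^sup>2"] by (simp add: mode_var_def mode_mean_def)

lemma increment_sq_integrable:
  assumes "0 \<le> s" "0 \<le> t"
  shows "integrable M (\<lambda>\<omega>. (mode t \<omega> - mode s \<omega>)\<^sup>2)"
proof (rule Bochner_Integration.integrable_bound)
  show "integrable M (\<lambda>\<omega>. 2 * (mode t \<omega>)\<^sup>2 + 2 * (mode s \<omega>)\<^sup>2)"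
    using mode_sq assms by simp
  show "(\<lambda>\<omega>. (mode t \<omega> - mode s \<omega>)\<^sup>2) \<in> borel_measurable M"
    using mode_meas assms by (intro borel_measurable_power borel_measurable_diff)
  show "AE \<omega> in M. norm ((mode t \<omega> - mode s \<omega>)\<^sup>2) \<le> norm (2 * (mode t \<omega>)\<^sup>2 + 2 * (mode s \<omega>)\<^sup>2)"
    using weighted_sq_diff_le[of 1] by (intro AE_I2) simp
qed

lemma mode_mean_add: "0 \<le> s \<Longrightarrow> 0 \<le> h \<Longrightarrow> mode_mean (s + h) = mode_mean s + mode_mean h"
  using increment_mean[of s "s + h"] mode_int[of s] mode_int[of "s + h"] mode_mean_0
  by (cases "h = 0") (auto simp: mode_mean_def)

text \<open>
The increments over disjoint intervals are independent, hence uncorrelated: the variance of the sum is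
the sum of the variances, and the square of the mean is added.
\<close>

lemma step_second_moment:
  assumes p: "p 0 = 0" "\<And>i. i < n \<Longrightarrow> p i < p (Suc i)"
  shows "integrable M (\<lambda>\<omega>. (step_integral n p c mode \<omega>)\<^sup>2)"
    and "expectation (\<lambda>\<omega>. (step_integral n p c mode \<omega>)\<^sup>2)
     = (\<Sum>i<n. (c i)\<^sup>2 * mode_var (p (Suc i) - p i)) + (\<Sum>i<n. c i * mode_mean (p (Suc i) - p i))\<^sup>2"
proof -
  define Y where "Y i \<omega> = mode (p (Suc i)) \<omega> - mode (p i) \<omega>" for i \<omega>
  have p0: "0 \<le> p i" if "i \<le> n" for i
    using that by (induction i) (use p(1) in simp, metis Suc_le_lessD less_imp_le order.trans p(2))
  have p1: "0 \<le> p i" "0 \<le> p (Suc i)" "p i < p (Suc i)" if "i < n" for i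
    using p0[of i] p0[of "Suc i"] p(2) that by auto
  have Ysq: "integrable M (\<lambda>\<omega>. (Y i \<omega>)\<^sup>2)" if "i < n" for i
    unfolding Y_def using increment_sq_integrable p1[OF that] by simp
  have Yint: "integrable M (Y i)" if "i < n" for i
    unfolding Y_def using mode_int p1[OF that] by simp
  have EY: "expectation (Y i) = mode_mean (p (Suc i) - p i)" if "i < n" for i
    unfolding Y_def using increment_mean p1[OF that] by simp
  have ind: "indep_vars (\<lambda>_. borel) Y {..<n}"
    using increments_indep[of p n] p by (simp add: Y_def[abs_def])
  have prodint: "integrable M (\<lambda>\<omega>. Y i \<omega> * Y j \<omega>)
      \<and> expectation (\<lambda>\<omega>. Y i \<omega> * Y j \<omega>) = mode_mean (p (Suc i) - p i) * mode_mean (p (Suc j) - p j)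
         + (if i = j then mode_var (p (Suc i) - p i) else 0)" if "i < n" "j < n" for i j
  proof (cases "i = j")
    case True
    have "mode_var (p (Suc i) - p i) = variance (Y i)"
      unfolding Y_def using increment_var p1[OF that(1)] by simp
    also have "\<dots> = expectation (\<lambda>\<omega>. (Y i \<omega>)\<^sup>2) - (expectation (Y i))\<^sup>2"
      using Yint Ysq that by (intro variance_eq) auto
    finally show ?thesis using True Ysq[OF that(1)] EY[OF that(1)] by (simp add: power2_eq_square)
  next
    case False
    have ind2: "indep_vars (\<lambda>_. borel) Y {i, j}"
      using indep_vars_subset[OF ind] that by auto
    have int2: "\<And>k. k \<in> {i, j} \<Longrightarrow> integrable M (Y k)" using Yint that by auto
    show ?thesis
      using indep_vars_lebesgue_integral[OF _ ind2 int2] indep_vars_integrable[OF _ ind2 int2] EY that False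
      by simp
  qed
  have sq: "(step_integral n p c mode \<omega>)\<^sup>2 = (\<Sum>i<n. \<Sum>j<n. c i * c j * (Y i \<omega> * Y j \<omega>))" for \<omega>
    unfolding step_integral_def power2_eq_square sum_product Y_def by (simp add: mult_ac)
  show "integrable M (\<lambda>\<omega>. (step_integral n p c mode \<omega>)\<^sup>2)"
    unfolding sq using prodint by (intro Bochner_Integration.integrable_sum integrable_mult_right) auto
  have "expectation (\<lambda>\<omega>. (step_integral n p c mode \<omega>)\<^sup>2)
    = (\<Sum>i<n. \<Sum>j<n. c i * c j * (mode_mean (p (Suc i) - p i) * mode_mean (p (Suc j) - p j)
         + (if i = j then mode_var (p (Suc i) - p i) else 0)))"
  proof -
    have "expectation (\<lambda>\<omega>. (step_integral n p c mode \<omega>)\<^sup>2)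
      = (\<Sum>i<n. expectation (\<lambda>\<omega>. \<Sum>j<n. c i * c j * (Y i \<omega> * Y j \<omega>)))"
      unfolding sq using prodint by (intro Bochner_Integration.integral_sum) auto
    also have "\<dots> = (\<Sum>i<n. \<Sum>j<n. expectation (\<lambda>\<omega>. c i * c j * (Y i \<omega> * Y j \<omega>)))"
      using prodint by (intro sum.cong refl Bochner_Integration.integral_sum) auto
    also have "\<dots> = (\<Sum>i<n. \<Sum>j<n. c i * c j * (mode_mean (p (Suc i) - p i) * mode_mean (p (Suc j) - p j)
         + (if i = j then mode_var (p (Suc i) - p i) else 0)))"
      using prodint by (intro sum.cong refl) auto
    finally show ?thesis .
  qed
  also have "\<dots> = (\<Sum>i<n. \<Sum>j<n. (c i * mode_mean (p (Suc i) - p i)) * (c j * mode_mean (p (Suc j) - p j)))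
      + (\<Sum>i<n. \<Sum>j<n. if i = j then (c i)\<^sup>2 * mode_var (p (Suc i) - p i) else 0)"
    unfolding sum.distrib[symmetric] by (intro sum.cong) (auto simp: algebra_simps power2_eq_square)
  also have "\<dots> = (\<Sum>i<n. (c i)\<^sup>2 * mode_var (p (Suc i) - p i)) + (\<Sum>i<n. c i * mode_mean (p (Suc i) - p i))\<^sup>2"
    by (simp add: power2_eq_square sum_product sum.delta)
  finally show "expectation (\<lambda>\<omega>. (step_integral n p c mode \<omega>)\<^sup>2)
     = (\<Sum>i<n. (c i)\<^sup>2 * mode_var (p (Suc i) - p i)) + (\<Sum>i<n. c i * mode_mean (p (Suc i) - p i))\<^sup>2" .
qed

lemma mode_var_nonneg: "0 \<le> mode_var t" unfolding mode_var_def by (rule Bochner_Integration.integral_nonneg) simp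

text \<open>
This is \<open>step_second_moment\<close> with unit weights on the partition \<open>0 < s < s + h\<close>, after the squares of
the means, which are additive, are cancelled.
\<close>

lemma mode_var_add:
  assumes "0 \<le> s" "0 \<le> h"
  shows "mode_var (s + h) = mode_var s + mode_var h"
proof (cases "s = 0 \<or> h = 0")
  case False
  define p where "p = (\<lambda>i::nat. if i = 0 then 0 else if i = 1 then s else s + h)"
  have p: "p 0 = 0" "\<And>i. i < 2 \<Longrightarrow> p i < p (Suc i)" using False assms by (auto simp: p_def less_2_cases_iff)
  have two: "(\<Sum>i<2. g i) = g 0 + g 1" for g :: "nat \<Rightarrow> real"
    by (simp add: numeral_2_eq_2)
  note z = mode_0
  have "mode_var (s + h) + (mode_mean (s + h))\<^sup>2 = expectation (\<lambda>\<omega>. (mode (s + h) \<omega>)\<^sup>2)"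
    unfolding mode_var_def using variance_eq[OF mode_int[of "s + h"] mode_sq[of "s + h"]] assms by (simp add: mode_mean_def)
  also have "\<dots> = expectation (\<lambda>\<omega>. (step_integral 2 p (\<lambda>_. 1) mode \<omega>)\<^sup>2)"
    by (rule integral_cong_AE)
       (use z mode_meas assms in \<open>auto simp: step_integral_def two p_def intro!: borel_measurable_power\<close>)
  also have "\<dots> = mode_var s + mode_var h + (mode_mean s + mode_mean h)\<^sup>2"
    using step_second_moment(2)[where n = 2 and p = p and c = "\<lambda>_. 1", OF p] by (simp add: two p_def)
  finally show ?thesis using mode_mean_add[OF assms] by simp
qed (auto simp: mode_var_0)

lemma mode_var_linear:
  assumes "0 \<le> t"
  shows "mode_var t = t * mode_var 1"
proof (rule additive_bounded_linear[where \<delta> = 1 and B = "mode_var 1"])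
  fix s :: real assume s: "0 \<le> s" "s \<le> 1"
  have "mode_var 1 = mode_var s + mode_var (1 - s)" using mode_var_add[of s "1 - s"] s by simp
  then show "\<bar>mode_var s\<bar> \<le> mode_var 1" using mode_var_nonneg[of s] mode_var_nonneg[of "1 - s"] by simp
qed (use mode_var_add assms in auto)

text \<open>
The mean is additive, so it only has to be bounded near zero. For small \<open>s\<close>, stochastic continuity
makes \<open>\<bar>L(s)\<bar> \<le> 1\<close> more likely than not for the mode, whereas Chebyshev's inequality keeps the mode
within a fixed distance of its mean with probability at least \<open>3/4\<close>; both events must overlap.
\<close>

lemma mode_mean_linear:
  assumes "0 \<le> t"
  shows "mode_mean t = t * mode_mean 1"
proof -
  let ?w = "(1 + real l * (real l + 1)) powr \<eta>"
  have w: "0 < ?w" by (simp add: add_nonneg_eq_0_iff)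
  have "((\<lambda>t. prob {\<omega> \<in> space M. sobolev_norm \<eta> (L t \<omega> - L 0 \<omega>) > sqrt ?w}) \<longlongrightarrow> 0) (at 0 within {0..})"
    using levy w unfolding levy_process_def by auto
  from order_tendstoD(2)[OF this, of "1/2"]
  obtain \<delta> where \<delta>: "\<delta> > 0" and d: "\<And>t. 0 < t \<Longrightarrow> t < \<delta> \<Longrightarrow> prob {\<omega> \<in> space M. sobolev_norm \<eta> (L t \<omega> - L 0 \<omega>) > sqrt ?w} < 1/2"
    unfolding eventually_at by (auto simp: dist_real_def)
  show ?thesis
  proof (rule additive_bounded_linear[where \<delta> = "min 1 (\<delta> / 2)" and B = "1 + 2 * sqrt (mode_var 1 + 1)"])
    fix s :: real assume s: "0 \<le> s" "s \<le> min 1 (\<delta> / 2)"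
    show "\<bar>mode_mean s\<bar> \<le> 1 + 2 * sqrt (mode_var 1 + 1)"
    proof (cases "s = 0")
      case False
      show ?thesis
      proof (rule ccontr)
        assume neg: "\<not> ?thesis"
        define r where "r = 2 * sqrt (mode_var 1 + 1)"
        have r: "0 < r" "r\<^sup>2 = 4 * (mode_var 1 + 1)" and mr: "1 + r < \<bar>mode_mean s\<bar>"
          using mode_var_nonneg[of 1] neg by (auto simp: power_mult_distrib add_nonneg_pos r_def)
        let ?A = "{\<omega> \<in> space M. sobolev_norm \<eta> (L s \<omega> - L 0 \<omega>) > sqrt ?w}"
        let ?B = "{\<omega> \<in> space M. \<bar>mode s \<omega> - mode_mean s\<bar> \<ge> r}"
        have a: "prob ?A < 1/2" using d[of s] False s \<delta> by auto
        have "prob ?B \<le> mode_var s / r\<^sup>2"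
          using Chebyshev_inequality[OF mode_meas[OF s(1)] mode_sq[OF s(1)] r(1)] by (simp add: mode_mean_def mode_var_def)
        also have "mode_var s / r\<^sup>2 \<le> mode_var 1 / r\<^sup>2"
          using mode_var_nonneg[of 1] s mode_var_linear[OF s(1)]
          by (intro divide_right_mono) (simp_all add: mult_left_le_one_le)
        also have "mode_var 1 / r\<^sup>2 \<le> 1 / 4"
          unfolding r(2) using mode_var_nonneg[of 1] by (simp add: divide_simps)
        finally have b: "prob ?B \<le> 1 / 4" .
        have mA: "?A \<in> events"
          using measurable_compose[OF increment_measurable[of 0 s] measurable_sobolev_norm] s False by simp
        have mB: "?B \<in> events" using mode_meas[OF s(1)] by simp
        have z: "AE \<omega> in M. L 0 \<omega> = 0" using levy unfolding levy_process_def by blast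
        have "AE \<omega> in M. \<omega> \<in> ?A \<union> ?B"
        proof (use z AE_space in eventually_elim)
          case (elim \<omega>)
          have "\<omega> \<in> ?B" if "\<omega> \<notin> ?A"
          proof -
            have "L s \<omega> \<in> sobolev \<eta>"
              using measurable_space[of "L s" M "sobolev_borel \<eta>" \<omega>] L2[OF s(1)] elim
              by (auto simp: L2_sobolev_def space_sobolev_borel)
            from sobolev_coeff_le[OF this lm] have "?w * (mode s \<omega>)\<^sup>2 \<le> (sobolev_norm \<eta> (L s \<omega>))\<^sup>2"
              by (simp add: mode_def)
            also have "\<dots> \<le> (sqrt ?w)\<^sup>2"
              using that elim by (intro power_mono sobolev_norm_nonneg) (auto simp: \<open>L s \<omega> \<in> _\<close>)
            also have "\<dots> = ?w" using w by simp
            finally have "(mode s \<omega>)\<^sup>2 \<le> 1" using w by simp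
            then have "\<bar>mode s \<omega>\<bar> \<le> 1" by (simp add: abs_square_le_1)
            then show ?thesis using mr elim by auto
          qed
          then show ?case by blast
        qed
        then have "prob (?A \<union> ?B) = 1"
          by (rule prob_eq_1[THEN iffD2, OF sets.Un[OF mA mB]])
        moreover have "prob (?A \<union> ?B) \<le> prob ?A + prob ?B"
          using mA mB by (rule measure_Un_le)
        ultimately show False using a b by simp
      qed
    qed (use mode_mean_0 mode_var_nonneg[of 1] in auto)
  qed (use mode_mean_add assms \<delta> in auto)
qed


text \<open>
The drift term is the square of \<open>\<Sum> c\<^sub>i (p\<^sub>i\<^sub>+\<^sub>1 - p\<^sub>i)\<close>; the Cauchy-Schwarz inequality dominates it by the
length of the interval times the square integral of the step function, so that both terms are
controlled by the latter.
\<close>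

lemma step_second_moment_le:
  assumes p: "p 0 = 0" "\<And>i. i < n \<Longrightarrow> p i < p (Suc i)"
  shows "(\<integral>\<^sup>+\<omega>. ennreal ((step_integral n p c mode \<omega>)\<^sup>2) \<partial>M)
    \<le> ennreal ((mode_var 1 + p n * (mode_mean 1)\<^sup>2) * (\<Sum>i<n. (c i)\<^sup>2 * (p (Suc i) - p i)))"
proof -
  have p0: "0 \<le> p (Suc i) - p i" if "i < n" for i using p(2)[OF that] by simp
  have p1: "p i \<le> p (Suc i)" if "i < n" for i using p(2)[OF that] by simp
  have tele: "(\<Sum>i<n. p (Suc i) - p i) = p n" using sum_lessThan_telescope[of p n] p(1) by simp
  have "(\<Sum>i<n. c i * (p (Suc i) - p i))\<^sup>2
     = (\<Sum>i<n. sqrt (p (Suc i) - p i) * (c i * sqrt (p (Suc i) - p i)))\<^sup>2"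
    by (intro arg_cong[where f = "\<lambda>x. x\<^sup>2"] sum.cong) (auto simp: p1 mult.left_commute)
  also have "\<dots> \<le> (\<Sum>i<n. (sqrt (p (Suc i) - p i))\<^sup>2) * (\<Sum>i<n. (c i * sqrt (p (Suc i) - p i))\<^sup>2)"
    by (rule Cauchy_Schwarz_ineq_sum)
  also have "\<dots> = p n * (\<Sum>i<n. (c i)\<^sup>2 * (p (Suc i) - p i))"
    unfolding tele[symmetric] by (intro arg_cong2[where f = "(*)"] sum.cong) (auto simp: p1 power_mult_distrib)
  finally have cs: "(\<Sum>i<n. c i * (p (Suc i) - p i))\<^sup>2 \<le> p n * (\<Sum>i<n. (c i)\<^sup>2 * (p (Suc i) - p i))" .
  have "expectation (\<lambda>\<omega>. (step_integral n p c mode \<omega>)\<^sup>2)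
    = (\<Sum>i<n. (c i)\<^sup>2 * ((p (Suc i) - p i) * mode_var 1)) + (\<Sum>i<n. c i * ((p (Suc i) - p i) * mode_mean 1))\<^sup>2"
  proof -
    have "expectation (\<lambda>\<omega>. (step_integral n p c mode \<omega>)\<^sup>2)
      = (\<Sum>i<n. (c i)\<^sup>2 * mode_var (p (Suc i) - p i)) + (\<Sum>i<n. c i * mode_mean (p (Suc i) - p i))\<^sup>2"
      by (rule step_second_moment(2)) (use p in auto)
    then show ?thesis using p0 by (simp add: mode_var_linear[OF p0] mode_mean_linear[OF p0])
  qed
  also have "\<dots> = mode_var 1 * (\<Sum>i<n. (c i)\<^sup>2 * (p (Suc i) - p i)) + (mode_mean 1)\<^sup>2 * (\<Sum>i<n. c i * (p (Suc i) - p i))\<^sup>2"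
    unfolding power_mult_distrib[symmetric] sum_distrib_left by (simp add: mult_ac)
  also have "\<dots> \<le> (mode_var 1 + p n * (mode_mean 1)\<^sup>2) * (\<Sum>i<n. (c i)\<^sup>2 * (p (Suc i) - p i))"
    using mult_left_mono[OF cs, of "(mode_mean 1)\<^sup>2"] by (simp add: algebra_simps)
  finally have "expectation (\<lambda>\<omega>. (step_integral n p c mode \<omega>)\<^sup>2)
     \<le> (mode_var 1 + p n * (mode_mean 1)\<^sup>2) * (\<Sum>i<n. (c i)\<^sup>2 * (p (Suc i) - p i))" .
  then show ?thesis
    using step_second_moment(1)[where p = p and n = n, OF p] by (subst nn_integral_eq_integral) (auto intro: ennreal_leI)
qed

text \<open>
Passage to the limit in \<open>step_second_moment_le\<close>. The factor 4 arises because \<open>a\<^sup>2 \<le> 2b\<^sup>2 + 2(a - b)\<^sup>2\<close>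
is used twice, once on \<open>\<Omega>\<close> and once on \<open>[0, t]\<close>; the drift accounts for \<open>1 + T\<close>.
\<close>

lemma levy_integral_second_moment:
  assumes I: "has_levy_integral M mode f t I" and t: "0 \<le> t" "t \<le> T"
  shows "(\<integral>\<^sup>+\<omega>. ennreal ((I \<omega>)\<^sup>2) \<partial>M)
    \<le> 4 * ennreal ((1 + T) * (mode_var 1 + (mode_mean 1)\<^sup>2)) * (\<integral>\<^sup>+s\<in>{0..t}. ennreal ((f s)\<^sup>2) \<partial>lborel)"
proof -
  define K where "K = (1 + T) * (mode_var 1 + (mode_mean 1)\<^sup>2)"
  define E where "E g = (\<integral>\<^sup>+s\<in>{0..t}. ennreal ((g s)\<^sup>2) \<partial>lborel)" for g :: "real \<Rightarrow> real"
  from I obtain n p c where fm: "f \<in> borel_measurable lborel" and Im: "I \<in> borel_measurable M"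
    and p: "\<And>k. p k 0 = 0" "\<And>k. p k (n k) = t" "\<And>k i. i < n k \<Longrightarrow> p k i < p k (Suc i)"
    and lim1: "(\<lambda>k. E (\<lambda>s. f s - step_fun (n k) (p k) (c k) s)) \<longlonglongrightarrow> 0"
    and lim2: "(\<lambda>k. \<integral>\<^sup>+\<omega>. ennreal ((I \<omega> - step_integral (n k) (p k) (c k) mode \<omega>)\<^sup>2) \<partial>M) \<longlonglongrightarrow> 0"
    unfolding has_levy_integral_def E_def by blast
  have "mode_var 1 + t * (mode_mean 1)\<^sup>2 \<le> 1 * mode_var 1 + T * (mode_mean 1)\<^sup>2"
    using t mode_var_nonneg[of 1] by (simp add: mult_right_mono)
  also have "\<dots> \<le> K"
    using t mode_var_nonneg[of 1] by (simp add: K_def algebra_simps)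
  finally have VK: "mode_var 1 + t * (mode_mean 1)\<^sup>2 \<le> K" .
  have K0: "0 \<le> K" using t mode_var_nonneg[of 1] by (simp add: K_def)
  have sm: "step_fun n p c \<in> borel_measurable lborel" for n p c
    unfolding step_fun_def by measurable
  have sq: "ennreal (a\<^sup>2) \<le> 2 * ennreal (b\<^sup>2) + 2 * ennreal ((a - b)\<^sup>2)" for a b :: real
  proof -
    have "a\<^sup>2 \<le> 2 * b\<^sup>2 + 2 * (a - b)\<^sup>2"
      using zero_le_power2[of "a - 2 * b"] by (simp add: power2_eq_square algebra_simps)
    then have "ennreal (a\<^sup>2) \<le> ennreal (2 * b\<^sup>2 + 2 * (a - b)\<^sup>2)" by (rule ennreal_leI)
    also have "\<dots> = 2 * ennreal (b\<^sup>2) + 2 * ennreal ((a - b)\<^sup>2)"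
      by (simp add: ennreal_plus ennreal_mult)
    finally show ?thesis .
  qed
  have step: "ennreal (\<Sum>i<n k. (c k i)\<^sup>2 * (p k (Suc i) - p k i)) \<le> E (step_fun (n k) (p k) (c k))" for k
    using step_fun_sq_integral_ge[where p = "p k" and n = "n k" and c = "c k"] p by (simp add: E_def)
  have bound: "(\<integral>\<^sup>+\<omega>. ennreal ((I \<omega>)\<^sup>2) \<partial>M)
     \<le> 2 * (ennreal K * (2 * E f + 2 * E (\<lambda>s. f s - step_fun (n k) (p k) (c k) s)))
       + 2 * (\<integral>\<^sup>+\<omega>. ennreal ((I \<omega> - step_integral (n k) (p k) (c k) mode \<omega>)\<^sup>2) \<partial>M)" for k
  proof -
    let ?S = "step_integral (n k) (p k) (c k) mode" and ?s = "step_fun (n k) (p k) (c k)"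
    have p0: "0 \<le> p k i" if "i \<le> n k" for i
      using that by (induction i) (use p(1) in simp, metis Suc_le_lessD less_imp_le order.trans p(3))
    have Sm: "?S \<in> borel_measurable M"
      unfolding step_integral_def
      by (intro borel_measurable_sum borel_measurable_times borel_measurable_const borel_measurable_diff mode_meas)
         (auto intro: p0)
    have "(\<integral>\<^sup>+\<omega>. ennreal ((I \<omega>)\<^sup>2) \<partial>M)
      \<le> (\<integral>\<^sup>+\<omega>. 2 * ennreal ((?S \<omega>)\<^sup>2) + 2 * ennreal ((I \<omega> - ?S \<omega>)\<^sup>2) \<partial>M)"
      by (intro nn_integral_mono sq)
    also have "\<dots> = 2 * (\<integral>\<^sup>+\<omega>. ennreal ((?S \<omega>)\<^sup>2) \<partial>M) + 2 * (\<integral>\<^sup>+\<omega>. ennreal ((I \<omega> - ?S \<omega>)\<^sup>2) \<partial>M)"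
      using Sm Im by (simp add: nn_integral_add nn_integral_cmult)
    also have "(\<integral>\<^sup>+\<omega>. ennreal ((?S \<omega>)\<^sup>2) \<partial>M) \<le> ennreal K * E ?s"
    proof -
      have "(\<integral>\<^sup>+\<omega>. ennreal ((?S \<omega>)\<^sup>2) \<partial>M)
        \<le> ennreal ((mode_var 1 + t * (mode_mean 1)\<^sup>2) * (\<Sum>i<n k. (c k i)\<^sup>2 * (p k (Suc i) - p k i)))"
        using step_second_moment_le[where p = "p k" and n = "n k" and c = "c k"] p by simp
      also have "\<dots> \<le> ennreal (K * (\<Sum>i<n k. (c k i)\<^sup>2 * (p k (Suc i) - p k i)))"
        using VK p(3) by (intro ennreal_leI mult_right_mono sum_nonneg mult_nonneg_nonneg) (auto simp: less_imp_le)
      also have "\<dots> = ennreal K * ennreal (\<Sum>i<n k. (c k i)\<^sup>2 * (p k (Suc i) - p k i))"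
        using K0 p(3) by (intro ennreal_mult sum_nonneg mult_nonneg_nonneg) (auto simp: less_imp_le)
      also have "\<dots> \<le> ennreal K * E ?s" by (intro mult_left_mono step) simp
      finally show ?thesis .
    qed
    also have "E ?s \<le> 2 * E f + 2 * E (\<lambda>s. f s - ?s s)"
    proof -
      have "E ?s \<le> (\<integral>\<^sup>+s. 2 * (ennreal ((f s)\<^sup>2) * indicator {0..t} s)
          + 2 * (ennreal ((f s - ?s s)\<^sup>2) * indicator {0..t} s) \<partial>lborel)"
        unfolding E_def
      proof (rule nn_integral_mono)
        fix s
        show "ennreal ((?s s)\<^sup>2) * indicator {0..t} s \<le> 2 * (ennreal ((f s)\<^sup>2) * indicator {0..t} s)
          + 2 * (ennreal ((f s - ?s s)\<^sup>2) * indicator {0..t} s)"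
          using sq[of "?s s" "f s"] by (cases "s \<in> {0..t}") (simp_all add: power2_commute)
      qed
      also have "\<dots> = 2 * E f + 2 * E (\<lambda>s. f s - ?s s)"
        unfolding E_def using fm sm[of "n k" "p k" "c k"] by (simp add: nn_integral_add nn_integral_cmult)
      finally show ?thesis .
    qed
    finally show ?thesis by (simp add: add_mono mult_left_mono)
  qed
  have "(\<lambda>k. 2 * (ennreal K * (2 * E f + 2 * E (\<lambda>s. f s - step_fun (n k) (p k) (c k) s)))
       + 2 * (\<integral>\<^sup>+\<omega>. ennreal ((I \<omega> - step_integral (n k) (p k) (c k) mode \<omega>)\<^sup>2) \<partial>M))
     \<longlonglongrightarrow> 2 * (ennreal K * (2 * E f + 2 * 0)) + 2 * 0"
    by (intro tendsto_add ennreal_tendsto_cmult tendsto_const lim1 lim2) (auto simp: ennreal_mult_less_top)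
  then have "(\<integral>\<^sup>+\<omega>. ennreal ((I \<omega>)\<^sup>2) \<partial>M) \<le> 2 * (ennreal K * (2 * E f + 2 * 0)) + 2 * 0"
    by (rule LIMSEQ_le_const) (use bound in auto)
  then show ?thesis unfolding E_def[of f, symmetric] K_def[symmetric] by (simp add: mult_ac)
qed

lemma levy_exp_integral_second_moment:
  assumes I: "has_levy_integral M mode (\<lambda>s. exp (- a * (t - s))) t I" and t: "0 \<le> t" "t \<le> T" and a: "0 < a"
  shows "integrable M (\<lambda>\<omega>. (I \<omega>)\<^sup>2)"
    and "expectation (\<lambda>\<omega>. (I \<omega>)\<^sup>2) \<le> 2 * (1 + T) * (mode_var 1 + (mode_mean 1)\<^sup>2) / a"
proof -
  have Im: "I \<in> borel_measurable M" using I by (simp add: has_levy_integral_def)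
  have "(\<integral>\<^sup>+s\<in>{0..t}. ennreal ((exp (- a * (t - s)))\<^sup>2) \<partial>lborel)
     = ennreal (exp (- 2 * a * (t - t)) / (2 * a) - exp (- 2 * a * (t - 0)) / (2 * a))"
  proof (rule nn_integral_FTC_Icc)
    show "((\<lambda>s. exp (- 2 * a * (t - s)) / (2 * a)) has_real_derivative (exp (- a * (t - s)))\<^sup>2) (at s)" for s
      using a by (auto intro!: derivative_eq_intros simp: exp_double[symmetric] field_simps)
  qed (use t in auto)
  also have "\<dots> \<le> ennreal (1 / (2 * a))" using a by (intro ennreal_leI) simp
  finally have f: "(\<integral>\<^sup>+s\<in>{0..t}. ennreal ((exp (- a * (t - s)))\<^sup>2) \<partial>lborel) \<le> ennreal (1 / (2 * a))" .
  have nn: "0 \<le> (1 + T) * (mode_var 1 + (mode_mean 1)\<^sup>2)" using t mode_var_nonneg[of 1] by simp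
  have "(\<integral>\<^sup>+\<omega>. ennreal ((I \<omega>)\<^sup>2) \<partial>M)
    \<le> 4 * ennreal ((1 + T) * (mode_var 1 + (mode_mean 1)\<^sup>2)) * ennreal (1 / (2 * a))"
    by (rule order.trans[OF levy_integral_second_moment[OF I t] mult_left_mono[OF f]]) simp
  also have "\<dots> = ennreal (4 * ((1 + T) * (mode_var 1 + (mode_mean 1)\<^sup>2)) * (1 / (2 * a)))"
  proof -
    have "4 * ennreal x * ennreal y = ennreal (4 * x * y)" if "0 \<le> x" "0 \<le> y" for x y
      using that by (simp add: ennreal_mult ennreal_numeral)
    then show ?thesis using nn a by simp
  qed
  also have "4 * ((1 + T) * (mode_var 1 + (mode_mean 1)\<^sup>2)) * (1 / (2 * a)) = 2 * (1 + T) * (mode_var 1 + (mode_mean 1)\<^sup>2) / a"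
    by simp
  finally have le: "(\<integral>\<^sup>+\<omega>. ennreal ((I \<omega>)\<^sup>2) \<partial>M) \<le> ennreal (2 * (1 + T) * (mode_var 1 + (mode_mean 1)\<^sup>2) / a)" .
  show int: "integrable M (\<lambda>\<omega>. (I \<omega>)\<^sup>2)"
    using Im le by (intro integrableI_bounded) (auto simp: le_less_trans[OF le])
  show "expectation (\<lambda>\<omega>. (I \<omega>)\<^sup>2) \<le> 2 * (1 + T) * (mode_var 1 + (mode_mean 1)\<^sup>2) / a"
  proof -
    have "0 \<le> 2 * (1 + T) * (mode_var 1 + (mode_mean 1)\<^sup>2) / a"
      using t a mode_var_nonneg[of 1] by (intro divide_nonneg_pos mult_nonneg_nonneg add_nonneg_nonneg) auto
    moreover have "ennreal (expectation (\<lambda>\<omega>. (I \<omega>)\<^sup>2)) \<le> ennreal (2 * (1 + T) * (mode_var 1 + (mode_mean 1)\<^sup>2) / a)"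
      using le int by (subst (asm) nn_integral_eq_integral) auto
    ultimately show ?thesis by (simp only: ennreal_le_iff)
  qed
qed

end

lemma (in levy_L2) levy_convolution_second_moment:
  assumes lm: "\<bar>m\<bar> \<le> int l"
    and I: "has_levy_integral M (\<lambda>s \<omega>. L s \<omega> l m) (\<lambda>s. exp (- a * (t - s))) t I"
    and t: "0 \<le> t" "t \<le> T" and a: "0 < a"
  shows "integrable M (\<lambda>\<omega>. (I \<omega>)\<^sup>2)"
    and "expectation (\<lambda>\<omega>. (I \<omega>)\<^sup>2)
      \<le> 2 * (1 + T) * (variance (\<lambda>\<omega>. L 1 \<omega> l m) + (expectation (\<lambda>\<omega>. L 1 \<omega> l m))\<^sup>2) / a"
proof -
  interpret levy_mode M \<eta> L l m by unfold_locales (rule lm)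
  have "has_levy_integral M mode (\<lambda>s. exp (- a * (t - s))) t I"
    using I unfolding mode_def[abs_def] .
  from levy_exp_integral_second_moment[OF this t a]
  show "integrable M (\<lambda>\<omega>. (I \<omega>)\<^sup>2)"
    and "expectation (\<lambda>\<omega>. (I \<omega>)\<^sup>2)
      \<le> 2 * (1 + T) * (variance (\<lambda>\<omega>. L 1 \<omega> l m) + (expectation (\<lambda>\<omega>. L 1 \<omega> l m))\<^sup>2) / a"
    by (simp_all only: mode_var_def mode_mean_def mode_def[abs_def])
qed

section \<open>Duality, Cauchy-Schwarz and passage to the limit\<close>

text \<open>
The fundamental theorem of calculus along the segment from \<open>s\<close> to \<open>x\<close>; the constant direction
\<open>x - s\<close> can be pulled out of the integral of the gradient.
\<close>

lemma GDERIV_segment_integral: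
  fixes \<phi> :: "'a::real_inner \<Rightarrow> real"
  assumes \<phi>: "\<And>f. GDERIV \<phi> f :> \<phi>' f"
    and int: "(\<lambda>y. \<phi>' (y *\<^sub>R x + (1 - y) *\<^sub>R s)) integrable_on {0..1}"
  shows "\<phi> x - \<phi> s = inner (integral {0..1} (\<lambda>y. \<phi>' (y *\<^sub>R x + (1 - y) *\<^sub>R s))) (x - s)"
proof -
  define p where "p y = y *\<^sub>R x + (1 - y) *\<^sub>R s" for y :: real
  have p: "(p has_derivative (\<lambda>h. h *\<^sub>R (x - s))) (at y within {0..1})" for y
    unfolding p_def by (auto intro!: derivative_eq_intros simp: algebra_simps)
  have "((\<lambda>y. \<phi> (p y)) has_vector_derivative inner (\<phi>' (p y)) (x - s)) (at y within {0..1})" for y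
  proof -
    have "(\<phi> has_derivative (\<lambda>h. inner h (\<phi>' (p y)))) (at (p y))"
      using \<phi>[of "p y"] by (simp add: gderiv_def)
    from has_derivative_compose[OF p this]
    show ?thesis
      by (simp add: has_vector_derivative_def inner_commute)
  qed
  then have "((\<lambda>y. inner (\<phi>' (p y)) (x - s)) has_integral \<phi> (p 1) - \<phi> (p 0)) {0..1}"
    by (intro fundamental_theorem_of_calculus) auto
  moreover have "((\<lambda>y. inner (\<phi>' (p y)) (x - s)) has_integral inner (integral {0..1} (\<lambda>y. \<phi>' (p y))) (x - s)) {0..1}"
    using has_integral_linear[OF integrable_integral[OF int] bounded_linear_inner_left[of "x - s"]]
    by (simp add: p_def o_def)
  ultimately have "\<phi> (p 1) - \<phi> (p 0) = inner (integral {0..1} (\<lambda>y. \<phi>' (p y))) (x - s)"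
    by (rule has_integral_unique)
  then show ?thesis by (simp add: p_def)
qed

text \<open>
The duality of \<open>H\<^bsup>-\<rho>\<^esup>\<close> and \<open>H\<^sup>\<rho>\<close>: the weights \<open>(1 + l(l+1))\<^bsup>-\<rho>/2\<^esup>\<close> and \<open>(1 + l(l+1))\<^bsup>\<rho>/2\<^esup>\<close> cancel in
the product, and the Cauchy-Schwarz inequality for finite sums applies.
\<close>

lemma tail_pairing_le:
  assumes z: "z \<in> sobolev \<rho>" and A: "finite A"
  shows "\<bar>\<Sum>l\<in>A. \<Sum>m = - int l..int l. c l m * z l m\<bar>
    \<le> sqrt (\<Sum>l\<in>A. \<Sum>m = - int l..int l. (1 + real l * (real l + 1)) powr (- \<rho>) * (c l m)\<^sup>2) * sobolev_norm \<rho> z"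
proof -
  let ?S = "Sigma A (\<lambda>l. {- int l..int l})"
  define w where "w l = 1 + real l * (real l + 1)" for l :: nat
  have w: "0 < w l" for l unfolding w_def by (simp add: add_pos_nonneg)
  define f g where "f = (\<lambda>(l, m). w l powr (- \<rho> / 2) * c l m)" and "g = (\<lambda>(l, m). w l powr (\<rho> / 2) * z l m)"
  note nn = sobolev_sq_nonneg[of \<rho> z]
  have f2: "(f (l, m))\<^sup>2 = w l powr (- \<rho>) * (c l m)\<^sup>2" and g2: "(g (l, m))\<^sup>2 = w l powr \<rho> * (z l m)\<^sup>2"
    and fg: "f (l, m) * g (l, m) = c l m * z l m" for l m
    using w[of l] by (simp_all add: f_def g_def power_mult_distrib powr_power powr_minus field_simps)
  have "(\<Sum>l\<in>A. \<Sum>m = - int l..int l. c l m * z l m)\<^sup>2 = (\<Sum>i\<in>?S. f i * g i)\<^sup>2"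
    using A by (simp add: sum.Sigma case_prod_unfold flip: fg)
  also have "\<dots> \<le> (\<Sum>i\<in>?S. (f i)\<^sup>2) * (\<Sum>i\<in>?S. (g i)\<^sup>2)"
    by (rule Cauchy_Schwarz_ineq_sum)
  also have "(\<Sum>i\<in>?S. (f i)\<^sup>2) = (\<Sum>l\<in>A. \<Sum>m = - int l..int l. w l powr (- \<rho>) * (c l m)\<^sup>2)"
    using A by (simp add: sum.Sigma case_prod_unfold flip: f2)
  also have "(\<Sum>i\<in>?S. (g i)\<^sup>2) = (\<Sum>l\<in>A. sobolev_sq \<rho> z l)"
    using A by (simp add: sobolev_sq_def sum.Sigma case_prod_unfold flip: g2 w_def)
  also have "\<dots> \<le> (\<Sum>l. sobolev_sq \<rho> z l)"
    using z nn A by (intro sum_le_suminf) (auto simp: sobolev_def)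
  also have "\<dots> = (sobolev_norm \<rho> z)\<^sup>2"
    using z nn by (simp add: sobolev_norm_def suminf_nonneg sobolev_def)
  finally have "(\<Sum>l\<in>A. \<Sum>m = - int l..int l. c l m * z l m)\<^sup>2
     \<le> (\<Sum>l\<in>A. \<Sum>m = - int l..int l. w l powr (- \<rho>) * (c l m)\<^sup>2) * (sobolev_norm \<rho> z)\<^sup>2"
    by (simp add: mult_left_mono sum_nonneg)
  then have "sqrt ((\<Sum>l\<in>A. \<Sum>m = - int l..int l. c l m * z l m)\<^sup>2)
     \<le> sqrt ((\<Sum>l\<in>A. \<Sum>m = - int l..int l. w l powr (- \<rho>) * (c l m)\<^sup>2) * (sobolev_norm \<rho> z)\<^sup>2)"
    by (rule real_sqrt_le_mono)
  then show ?thesis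
    using sobolev_norm_nonneg[OF z] by (simp add: real_sqrt_mult w_def)
qed

lemma nn_integral_mult_le_L2:
  fixes f g :: "'a \<Rightarrow> real"
  assumes f: "integrable M (\<lambda>x. (f x)\<^sup>2)" "f \<in> borel_measurable M" "\<And>x. x \<in> space M \<Longrightarrow> 0 \<le> f x"
    and g: "integrable M (\<lambda>x. (g x)\<^sup>2)" "g \<in> borel_measurable M" "\<And>x. x \<in> space M \<Longrightarrow> 0 \<le> g x"
  shows "(\<integral>\<^sup>+x. ennreal (f x * g x) \<partial>M) \<le> ennreal (sqrt (\<integral>x. (f x)\<^sup>2 \<partial>M) * sqrt (\<integral>x. (g x)\<^sup>2 \<partial>M))"
proof -
  define a b where "a = (\<integral>x. (f x)\<^sup>2 \<partial>M)" and "b = (\<integral>x. (g x)\<^sup>2 \<partial>M)"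
  have ab: "0 \<le> a" "0 \<le> b" by (simp_all add: a_def b_def)
  let ?I = "\<integral>\<^sup>+x. ennreal (f x) * ennreal (g x) \<partial>M"
  have "?I ^ 2 \<le> (\<integral>\<^sup>+x. ennreal (f x) ^ 2 \<partial>M) * (\<integral>\<^sup>+x. ennreal (g x) ^ 2 \<partial>M)"
    using f g by (intro Cauchy_Schwarz_nn_integral) auto
  also have "(\<integral>\<^sup>+x. ennreal (f x) ^ 2 \<partial>M) = (\<integral>\<^sup>+x. ennreal ((f x)\<^sup>2) \<partial>M)"
    using f(3) by (intro nn_integral_cong) (simp add: ennreal_power)
  also have "\<dots> = ennreal a" using f by (subst nn_integral_eq_integral) (auto simp: a_def)
  also have "(\<integral>\<^sup>+x. ennreal (g x) ^ 2 \<partial>M) = (\<integral>\<^sup>+x. ennreal ((g x)\<^sup>2) \<partial>M)"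
    using g(3) by (intro nn_integral_cong) (simp add: ennreal_power)
  also have "\<dots> = ennreal b" using g by (subst nn_integral_eq_integral) (auto simp: b_def)
  finally have I: "?I ^ 2 \<le> ennreal (a * b)" using ab by (simp add: ennreal_mult)
  have "?I \<le> ennreal (sqrt (a * b))"
  proof (cases ?I)
    case (real r)
    then have "r\<^sup>2 \<le> a * b" using I ab by (simp add: ennreal_power)
    then have "r \<le> sqrt (a * b)" by (rule real_le_rsqrt)
    then show ?thesis using real by (simp add: ennreal_leI)
  next
    case top
    then show ?thesis using I by (simp add: power2_eq_square ennreal_mult_top top_unique)
  qed
  moreover have "(\<integral>\<^sup>+x. ennreal (f x * g x) \<partial>M) = ?I"
    using f(3) g(3) by (intro nn_integral_cong) (simp add: ennreal_mult)
  ultimately show ?thesis by (simp add: a_def b_def real_sqrt_mult)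
qed

lemma (in complete_measure) borel_measurable_AE_eq:
  fixes f g :: "'a \<Rightarrow> 'b::topological_space"
  assumes f: "f \<in> borel_measurable M" and ae: "AE x in M. f x = g x"
  shows "g \<in> borel_measurable M"
proof (rule measurableI)
  fix A :: "'b set" assume "A \<in> sets borel"
  then have A: "f -` A \<inter> space M \<in> sets M" using f by (rule measurable_sets[rotated])
  have iff: "AE x in M. x \<in> f -` A \<inter> space M \<longleftrightarrow> x \<in> g -` A \<inter> space M"
    using ae by eventually_elim auto
  show "g -` A \<inter> space M \<in> sets M" by (rule in_sets_AE[OF iff A]) auto
qed simp

text \<open>
Fatou's lemma. The limit is measurable because the measure is complete.
\<close>

lemma (in complete_measure) integral_le_of_AE_limit:
  fixes R :: "'a \<Rightarrow> real"
  assumes meas: "\<And>N. S N \<in> borel_measurable M"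
    and lim: "AE x in M. (\<lambda>N. S N x) \<longlonglongrightarrow> R x"
    and bound: "\<And>N::nat. (\<integral>\<^sup>+x. ennreal \<bar>S N x\<bar> \<partial>M) \<le> ennreal B" and B: "0 \<le> B"
  shows "integrable M R \<and> \<bar>\<integral>x. R x \<partial>M\<bar> \<le> B"
proof -
  have "AE x in M. lim (\<lambda>N. S N x) = R x" using lim by eventually_elim (rule limI)
  moreover have "(\<lambda>x. lim (\<lambda>N. S N x)) \<in> borel_measurable M" using meas by measurable
  ultimately have R: "R \<in> borel_measurable M" by (rule borel_measurable_AE_eq[rotated])
  have "(\<integral>\<^sup>+x. ennreal \<bar>R x\<bar> \<partial>M) = (\<integral>\<^sup>+x. liminf (\<lambda>N. ennreal \<bar>S N x\<bar>) \<partial>M)"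
  proof (rule nn_integral_cong_AE, use lim in eventually_elim)
    case (elim x)
    have "(\<lambda>N. ennreal \<bar>S N x\<bar>) \<longlonglongrightarrow> ennreal \<bar>R x\<bar>" by (intro tendsto_intros elim)
    from lim_imp_Liminf[OF _ this] show ?case by simp
  qed
  also have "\<dots> \<le> liminf (\<lambda>N. \<integral>\<^sup>+x. ennreal \<bar>S N x\<bar> \<partial>M)"
    using meas by (intro nn_integral_liminf) auto
  also have "\<dots> \<le> ennreal B"
    using bound by (intro Liminf_le) auto
  finally have le: "(\<integral>\<^sup>+x. ennreal \<bar>R x\<bar> \<partial>M) \<le> ennreal B" .
  then have int: "integrable M R"
    using R by (intro integrableI_bounded) (auto simp: le_less_trans[OF le])
  have "\<bar>\<integral>x. R x \<partial>M\<bar> \<le> (\<integral>x. \<bar>R x\<bar> \<partial>M)" by (rule integral_abs_bound)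
  also have "ennreal (\<integral>x. \<bar>R x\<bar> \<partial>M) \<le> ennreal B"
    using le int by (subst nn_integral_eq_integral[symmetric]) auto
  then have "(\<integral>x. \<bar>R x\<bar> \<partial>M) \<le> B" using B by simp
  finally show ?thesis using int by simp
qed

section \<open>Decay of the noise tails\<close>

text \<open>
Telescoping: by the mean value theorem the term with index \<open>l + 1\<close> is at most the increment of
\<open>-x\<^bsup>-s\<^esup>/s\<close> over \<open>[l, l + 1]\<close>.
\<close>

lemma powr_sum_tail_le:
  fixes s :: real and \<kappa> N :: nat
  assumes s: "0 < s" and \<kappa>: "1 \<le> \<kappa>"
  shows "(\<Sum>l\<in>{\<kappa><..N}. real l powr (- 1 - s)) \<le> real \<kappa> powr (- s) / s"
proof (cases "\<kappa> \<le> N")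
  case True
  have step: "real (Suc l) powr (- 1 - s) \<le> (real l powr (- s) - real (Suc l) powr (- s)) / s" if l: "1 \<le> l" for l :: nat
  proof -
    have "\<exists>z. real l < z \<and> z < real (Suc l) \<and>
      real (Suc l) powr (- s) - real l powr (- s) = (real (Suc l) - real l) * ((- s) * z powr (- s - 1))"
    proof (rule MVT2)
      fix z assume "real l \<le> z"
      then show "((\<lambda>z. z powr (- s)) has_real_derivative - s * z powr (- s - 1)) (at z)"
        using l by (intro has_real_derivative_powr) simp
    qed simp
    then obtain z where z: "real l < z" "z < real (Suc l)"
      and e: "real (Suc l) powr (- s) - real l powr (- s) = - s * z powr (- s - 1)" by auto
    have "real (Suc l) powr (- s - 1) \<le> z powr (- s - 1)"
      using z l s by (intro powr_mono2') auto
    then have "s * real (Suc l) powr (- s - 1) \<le> real l powr (- s) - real (Suc l) powr (- s)"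
      using e mult_left_mono[of "real (Suc l) powr (- s - 1)" "z powr (- s - 1)" s] s by linarith
    moreover have "- s - 1 = - 1 - s" by simp
    ultimately show ?thesis using s by (simp only: pos_le_divide_eq mult.commute)
  qed
  have "(\<Sum>l\<in>{\<kappa><..N}. real l powr (- 1 - s)) \<le> (real \<kappa> powr (- s) - real N powr (- s)) / s"
    using True
  proof (induction N rule: dec_induct)
    case (step n)
    have "{\<kappa><..Suc n} = insert (Suc n) {\<kappa><..n}" using step(1) by auto
    then have "(\<Sum>l\<in>{\<kappa><..Suc n}. real l powr (- 1 - s)) = real (Suc n) powr (- 1 - s) + (\<Sum>l\<in>{\<kappa><..n}. real l powr (- 1 - s))"
      by simp
    also have "\<dots> \<le> (real n powr (- s) - real (Suc n) powr (- s)) / s + (real \<kappa> powr (- s) - real n powr (- s)) / s"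
      using step.IH \<open>\<And>l. 1 \<le> l \<Longrightarrow> _\<close>[of n] step(1) \<kappa> by (intro add_mono) auto
    finally show ?case by (simp add: diff_divide_distrib)
  qed simp
  also have "\<dots> \<le> real \<kappa> powr (- s) / s" using s by (intro divide_right_mono) auto
  finally show ?thesis .
qed (use s in simp)

text \<open>
For \<open>l > \<kappa>\<close> the factor \<open>1/(l(l+1))\<close> is at most twice \<open>1/(1 + l(l+1))\<close>, so the summand is a power
\<open>-(\<eta> + 1 + \<rho>)\<close> of \<open>1 + l(l+1) \<ge> \<kappa>\<^sup>2\<close> times a term of the convergent series.
\<close>

lemma noise_tail_summable:
  fixes Q :: "nat \<Rightarrow> real"
  assumes sm: "summable (\<lambda>l. (1 + real l * (real l + 1)) powr \<eta> * Q l)" and Q: "\<And>l. 0 \<le> Q l"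
    and e: "0 \<le> \<rho> + \<eta> + 1"
  shows "\<exists>D\<ge>0. \<forall>\<kappa>\<ge>1. \<forall>N. (\<Sum>l\<in>{\<kappa><..N}. (1 + real l * (real l + 1)) powr (- \<rho>) * (Q l / (real l * (real l + 1))))
    \<le> D * (real \<kappa> powr (- (\<eta> + 1 + \<rho>)))\<^sup>2"
proof -
  define w where "w l = 1 + real l * (real l + 1)" for l :: nat
  define S where "S = (\<Sum>l. w l powr \<eta> * Q l)"
  have sm': "summable (\<lambda>l. w l powr \<eta> * Q l)" using sm by (simp add: w_def)
  have S: "0 \<le> S" unfolding S_def using sm' Q by (intro suminf_nonneg) auto
  have "(\<Sum>l\<in>{\<kappa><..N}. w l powr (- \<rho>) * (Q l / (real l * (real l + 1)))) \<le> (2 * S) * (real \<kappa> powr (- (\<eta> + 1 + \<rho>)))\<^sup>2"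
    if \<kappa>: "1 \<le> \<kappa>" for \<kappa> N
  proof -
    have "w l powr (- \<rho>) * (Q l / (real l * (real l + 1))) \<le> 2 * (real \<kappa> powr (- (\<eta> + 1 + \<rho>)))\<^sup>2 * (w l powr \<eta> * Q l)"
      if l: "l \<in> {\<kappa><..N}" for l
    proof -
      have l1: "1 \<le> real l" "real \<kappa> \<le> real l" using l \<kappa> by auto
      have lam: "1 \<le> real l * (real l + 1)" using mult_mono[of 1 "real l" 1 "real l + 1"] l1 by simp
      have wl: "1 < w l" "w l \<le> 2 * (real l * (real l + 1))" using lam by (auto simp: w_def)
      have "(real \<kappa>)\<^sup>2 \<le> real l * (real l + 1)"
        unfolding power2_eq_square using l1 by (intro mult_mono) auto
      then have kw: "(real \<kappa>)\<^sup>2 \<le> w l" by (simp add: w_def)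
      have "Q l / (real l * (real l + 1)) \<le> 2 * Q l / w l"
        using divide_left_mono[OF wl(2), of "2 * Q l"] wl lam Q[of l] by simp
      then have "w l powr (- \<rho>) * (Q l / (real l * (real l + 1))) \<le> w l powr (- \<rho>) * (2 * Q l / w l)"
        by (intro mult_left_mono) auto
      also have "\<dots> = 2 * (w l powr (- (\<eta> + 1 + \<rho>)) * (w l powr \<eta> * Q l))"
      proof -
        have "w l powr (- (\<eta> + 1 + \<rho>)) * w l powr \<eta> = w l powr (- \<rho> - 1)"
          unfolding powr_add[symmetric] by (rule arg_cong[where f = "(powr) (w l)"]) simp
        also have "\<dots> = w l powr (- \<rho>) / w l" using wl by (simp add: powr_diff)
        finally show ?thesis by (simp add: mult.assoc[symmetric])
      qed
      also have "\<dots> \<le> 2 * (((real \<kappa>)\<^sup>2) powr (- (\<eta> + 1 + \<rho>)) * (w l powr \<eta> * Q l))"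
        using kw \<kappa> e Q[of l] by (intro mult_left_mono mult_right_mono powr_mono2') auto
      also have "((real \<kappa>)\<^sup>2) powr (- (\<eta> + 1 + \<rho>)) = (real \<kappa> powr (- (\<eta> + 1 + \<rho>)))\<^sup>2"
        using \<kappa> by (simp add: powr_mult power2_eq_square)
      finally show ?thesis by (simp add: mult_ac)
    qed
    then have "(\<Sum>l\<in>{\<kappa><..N}. w l powr (- \<rho>) * (Q l / (real l * (real l + 1))))
       \<le> 2 * (real \<kappa> powr (- (\<eta> + 1 + \<rho>)))\<^sup>2 * (\<Sum>l\<in>{\<kappa><..N}. w l powr \<eta> * Q l)"
      unfolding sum_distrib_left by (rule sum_mono)
    also have "\<dots> \<le> 2 * (real \<kappa> powr (- (\<eta> + 1 + \<rho>)))\<^sup>2 * S"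
      unfolding S_def using sm' Q by (intro mult_left_mono sum_le_suminf) auto
    finally show ?thesis by (simp add: mult_ac)
  qed
  then show ?thesis using S unfolding w_def by (intro exI[of _ "2 * S"]) auto
qed

text \<open>
Here \<open>Q l\<close> stands for the total second moment of the \<open>2l + 1\<close> modes of degree \<open>l\<close>; the summand is at most a
constant times \<open>l\<^bsup>-1-\<alpha>-2\<rho>\<^esup>\<close>.
\<close>

lemma noise_tail_polynomial:
  fixes Q :: "nat \<Rightarrow> real"
  assumes Q: "\<And>l. 1 \<le> l \<Longrightarrow> Q l \<le> (2 * real l + 1) * (G * real l powr (- \<alpha>))" and G: "0 \<le> G"
    and \<alpha>: "0 < \<alpha>" and \<rho>: "0 \<le> \<rho>"
  shows "\<exists>D\<ge>0. \<forall>\<kappa>\<ge>1. \<forall>N. (\<Sum>l\<in>{\<kappa><..N}. (1 + real l * (real l + 1)) powr (- \<rho>) * (Q l / (real l * (real l + 1))))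
    \<le> D * (real \<kappa> powr (- (\<alpha> / 2 + \<rho>)))\<^sup>2"
proof -
  define s where "s = \<alpha> + 2 * \<rho>"
  have s: "0 < s" using \<alpha> \<rho> by (simp add: s_def)
  have "(\<Sum>l\<in>{\<kappa><..N}. (1 + real l * (real l + 1)) powr (- \<rho>) * (Q l / (real l * (real l + 1))))
     \<le> (3 * G / s) * (real \<kappa> powr (- (\<alpha> / 2 + \<rho>)))\<^sup>2" if \<kappa>: "1 \<le> \<kappa>" for \<kappa> N
  proof -
    have "(1 + real l * (real l + 1)) powr (- \<rho>) * (Q l / (real l * (real l + 1))) \<le> 3 * G * real l powr (- 1 - s)"
      if l: "l \<in> {\<kappa><..N}" for l
    proof -
      have l1: "1 \<le> real l" "1 \<le> l" using l \<kappa> by auto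
      have ll: "(real l)\<^sup>2 \<le> 1 + real l * (real l + 1)" by (simp add: power2_eq_square algebra_simps)
      have "Q l / (real l * (real l + 1)) \<le> (2 * real l + 1) * (G * real l powr (- \<alpha>)) / (real l * (real l + 1))"
        using Q[OF l1(2)] l1 by (intro divide_right_mono) auto
      also have "\<dots> \<le> (3 * real l) * (G * real l powr (- \<alpha>)) / (real l * real l)"
        using l1 G by (intro frac_le mult_mono) auto
      also have "\<dots> = 3 * G * real l powr (- \<alpha> - 1)"
        using l1 by (simp add: powr_diff)
      finally have q: "Q l / (real l * (real l + 1)) \<le> 3 * G * real l powr (- \<alpha> - 1)" .
      have "(1 + real l * (real l + 1)) powr (- \<rho>) \<le> ((real l)\<^sup>2) powr (- \<rho>)"
        using ll l1 \<rho> by (intro powr_mono2') auto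
      also have "\<dots> = real l powr (- 2 * \<rho>)"
        using l1 by (simp add: power2_eq_square powr_mult powr_add[symmetric])
      finally have "(1 + real l * (real l + 1)) powr (- \<rho>) * (Q l / (real l * (real l + 1)))
        \<le> real l powr (- 2 * \<rho>) * (3 * G * real l powr (- \<alpha> - 1))"
        using q G by (intro order.trans[OF mult_left_mono[OF q] mult_right_mono]) auto
      also have "\<dots> = 3 * G * real l powr (- 1 - s)"
      proof -
        have "real l powr (- 2 * \<rho>) * real l powr (- \<alpha> - 1) = real l powr (- 1 - s)"
          unfolding powr_add[symmetric] by (rule arg_cong[where f = "(powr) (real l)"]) (simp add: s_def)
        then show ?thesis by (simp add: mult.left_commute)
      qed
      finally show ?thesis .
    qed
    then have "(\<Sum>l\<in>{\<kappa><..N}. (1 + real l * (real l + 1)) powr (- \<rho>) * (Q l / (real l * (real l + 1))))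
      \<le> 3 * G * (\<Sum>l\<in>{\<kappa><..N}. real l powr (- 1 - s))"
      unfolding sum_distrib_left by (rule sum_mono)
    also have "\<dots> \<le> 3 * G * (real \<kappa> powr (- s) / s)"
      using G by (intro mult_left_mono powr_sum_tail_le s \<kappa>) auto
    also have "real \<kappa> powr (- s) = (real \<kappa> powr (- (\<alpha> / 2 + \<rho>)))\<^sup>2"
      using \<kappa> by (simp add: s_def powr_power)
    finally show ?thesis by simp
  qed
  then show ?thesis using G s by (intro exI[of _ "3 * G / s"]) auto
qed

section \<open>The weak error of the spectral approximation\<close>

text \<open>
The estimate for a single truncation level and a single time, with the contribution of the noise
abstracted to the bound \<open>B\<close> on its part of the \<open>L\<^sup>2(\<Omega>, H\<^bsup>-\<rho>\<^esup>)\<close> norm. All estimates are made for the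
finite sums over \<open>\<kappa> < l \<le> N\<close>, uniformly in \<open>N\<close>, so that the almost sure convergence of the expansion is
enough to pass to the limit.
\<close>

lemma weak_error_bound:
  fixes M :: "'w measure" and X0 :: "'w \<Rightarrow> l2_sphere" and I :: "nat \<Rightarrow> int \<Rightarrow> real \<Rightarrow> 'w \<Rightarrow> real"
    and x s :: "'w \<Rightarrow> l2_sphere" and Z :: "'w \<Rightarrow> coeffs" and t \<rho> B K :: real and \<kappa> :: nat
  defines "s \<equiv> spectral_approx X0 I \<kappa> t"
  assumes prob: "prob_space M" and complete: "complete_measure M"
    and X0: "X0 \<in> borel_measurable M" "integrable M (\<lambda>\<omega>. (norm (X0 \<omega>))\<^sup>2)"
    and I: "\<And>l m. \<bar>m\<bar> \<le> int l \<Longrightarrow> I l m t \<in> borel_measurable M"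
      "\<And>l m. \<bar>m\<bar> \<le> int l \<Longrightarrow> \<kappa> < l \<Longrightarrow> integrable M (\<lambda>\<omega>. (I l m t \<omega>)\<^sup>2)"
    and B: "0 \<le> B" "\<And>N. (\<Sum>l\<in>{\<kappa><..N}. \<Sum>m = - int l..int l.
        (1 + real l * (real l + 1)) powr (- \<rho>) * (\<integral>\<omega>. (I l m t \<omega>)\<^sup>2 \<partial>M)) \<le> B\<^sup>2"
    and x: "AE \<omega> in M. (\<lambda>l. solution_part X0 I l t \<omega>) sums x \<omega>"
    and \<phi>: "\<And>f. GDERIV \<phi> f :> \<phi>' f"
    and seg: "AE \<omega> in M. (\<lambda>y. \<phi>' (y *\<^sub>R x \<omega> + (1 - y) *\<^sub>R s \<omega>)) integrable_on {0..1::real}"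
    and Z: "Z \<in> L2_sobolev M \<rho>" "L2_norm M (sobolev_norm \<rho>) Z \<le> K"
      "AE \<omega> in M. Z \<omega> = sph_coeffs (integral {0..1} (\<lambda>y. \<phi>' (y *\<^sub>R x \<omega> + (1 - y) *\<^sub>R s \<omega>)))"
    and t: "0 \<le> t" and \<rho>: "0 \<le> \<rho>"
  shows "integrable M (\<lambda>\<omega>. \<phi> (x \<omega>) - \<phi> (s \<omega>)) \<and>
    \<bar>\<integral>\<omega>. \<phi> (x \<omega>) - \<phi> (s \<omega>) \<partial>M\<bar>
      \<le> 2 * K * (exp (- (real \<kappa> + 1)\<^sup>2 * t) * (real \<kappa> + 1) powr (- \<rho>) * L2_norm M norm X0 + B)"
proof -
  interpret prob_space M by (rule prob)
  interpret complete_measure M by (rule complete)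
  define lam where "lam l = real l * (real l + 1)" for l :: nat
  define c where "c l m \<omega> = exp (- lam l * t) * inner (X0 \<omega>) (harm l m) + I l m t \<omega>" for l m \<omega>
  define w where "w l = (1 + lam l) powr (- \<rho>)" for l
  define S where "S N \<omega> = (\<Sum>l\<in>{\<kappa><..N}. \<Sum>m = - int l..int l. c l m \<omega> * Z \<omega> l m)" for N \<omega>
  define H where "H N \<omega> = (\<Sum>l\<in>{\<kappa><..N}. \<Sum>m = - int l..int l. w l * (c l m \<omega>)\<^sup>2)" for N \<omega>
  define A where "A = exp (- (real \<kappa> + 1)\<^sup>2 * t) * (real \<kappa> + 1) powr (- \<rho>)"
  define a where "a = L2_norm M norm X0"
  have A0: "0 \<le> A" by (simp add: A_def)
  have a0: "0 \<le> a" and a2: "a\<^sup>2 = (\<integral>\<omega>. (norm (X0 \<omega>))\<^sup>2 \<partial>M)" by (simp_all add: a_def L2_norm_def)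
  have w0: "0 \<le> w l" for l by (simp add: w_def)
  have X0m: "(\<lambda>\<omega>. inner (X0 \<omega>) h) \<in> borel_measurable M" for h
    by (rule measurable_compose[OF X0(1) borel_measurable_continuous_onI]) (intro continuous_intros)
  have cm: "c l m \<in> borel_measurable M" if "\<bar>m\<bar> \<le> int l" for l m
    unfolding c_def using X0m I(1)[OF that] by measurable
  have Zm: "Z \<in> M \<rightarrow>\<^sub>M sobolev_borel \<rho>" and Zi: "integrable M (\<lambda>\<omega>. (sobolev_norm \<rho> (Z \<omega>))\<^sup>2)"
    using Z(1) by (auto simp: L2_sobolev_def)
  have Zs: "Z \<omega> \<in> sobolev \<rho>" if "\<omega> \<in> space M" for \<omega>
    using measurable_space[OF Zm that] by (simp add: space_sobolev_borel)
  have Zlm: "(\<lambda>\<omega>. Z \<omega> l m) \<in> borel_measurable M" if "\<bar>m\<bar> \<le> int l" for l m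
    using measurable_compose[OF Zm measurable_sobolev_coeff[OF that]] .
  have Zn: "(\<lambda>\<omega>. sobolev_norm \<rho> (Z \<omega>)) \<in> borel_measurable M"
    using measurable_compose[OF Zm measurable_sobolev_norm] .
  have Sm: "S N \<in> borel_measurable M" for N
    unfolding S_def by (intro borel_measurable_sum borel_measurable_times cm Zlm) auto
  have Hm: "H N \<in> borel_measurable M" for N
    unfolding H_def by (intro borel_measurable_sum borel_measurable_times borel_measurable_power borel_measurable_const cm) auto
  have H0: "0 \<le> H N \<omega>" for N \<omega>
    unfolding H_def by (intro sum_nonneg mult_nonneg_nonneg w0) auto
  have K0: "0 \<le> K" using Z(2) by (rule order.trans[rotated]) (simp add: L2_norm_def)

  \<comment> \<open>For \<open>l > \<kappa>\<close> the eigenvalue \<open>l(l+1)\<close> is at least \<open>(\<kappa> + 1)\<^sup>2\<close>, which drives both the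
    exponential and the weight.\<close>
  have decay: "w l * (exp (- lam l * t))\<^sup>2 \<le> A\<^sup>2" if l: "\<kappa> < l" for l
  proof -
    have "real \<kappa> + 1 \<le> real l" using l by simp
    then have lk: "(real \<kappa> + 1)\<^sup>2 \<le> lam l"
      unfolding lam_def power2_eq_square by (intro mult_mono) auto
    have "w l \<le> ((real \<kappa> + 1)\<^sup>2) powr (- \<rho>)"
      unfolding w_def using lk \<rho> by (intro powr_mono2') auto
    also have "\<dots> = ((real \<kappa> + 1) powr (- \<rho>))\<^sup>2"
      by (simp add: power2_eq_square powr_mult)
    finally have 1: "w l \<le> ((real \<kappa> + 1) powr (- \<rho>))\<^sup>2" .
    have "exp (- lam l * t) \<le> exp (- (real \<kappa> + 1)\<^sup>2 * t)"
      using mult_right_mono[OF lk t] by simp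
    then have "(exp (- lam l * t))\<^sup>2 \<le> (exp (- (real \<kappa> + 1)\<^sup>2 * t))\<^sup>2" by (intro power_mono) auto
    from mult_mono[OF 1 this] show ?thesis by (simp add: A_def power_mult_distrib mult.commute)
  qed
  \<comment> \<open>The initial part is summed by Bessel's inequality, pathwise and uniformly in \<open>N\<close>.\<close>
  have Hle: "H N \<omega> \<le> 2 * A\<^sup>2 * (norm (X0 \<omega>))\<^sup>2
      + 2 * (\<Sum>l\<in>{\<kappa><..N}. \<Sum>m = - int l..int l. w l * (I l m t \<omega>)\<^sup>2)" for N \<omega>
  proof -
    have "w l * (c l m \<omega>)\<^sup>2 \<le> 2 * A\<^sup>2 * (inner (X0 \<omega>) (harm l m))\<^sup>2 + 2 * (w l * (I l m t \<omega>)\<^sup>2)"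
      if l: "l \<in> {\<kappa><..N}" for l m
    proof -
      have "w l * (c l m \<omega>)\<^sup>2 \<le> 2 * (w l * (exp (- lam l * t) * inner (X0 \<omega>) (harm l m))\<^sup>2) + 2 * (w l * (I l m t \<omega>)\<^sup>2)"
        using weighted_sq_diff_le[OF w0[of l], of "exp (- lam l * t) * inner (X0 \<omega>) (harm l m)" "- I l m t \<omega>"]
        by (simp add: c_def)
      also have "w l * (exp (- lam l * t) * inner (X0 \<omega>) (harm l m))\<^sup>2
          = w l * (exp (- lam l * t))\<^sup>2 * (inner (X0 \<omega>) (harm l m))\<^sup>2"
        by (simp only: power_mult_distrib mult.assoc)
      also have "\<dots> \<le> A\<^sup>2 * (inner (X0 \<omega>) (harm l m))\<^sup>2"
        using decay[of l] l by (intro mult_right_mono) auto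
      finally show ?thesis by simp
    qed
    then have "H N \<omega> \<le> (\<Sum>l\<in>{\<kappa><..N}. \<Sum>m = - int l..int l.
       2 * A\<^sup>2 * (inner (X0 \<omega>) (harm l m))\<^sup>2 + 2 * (w l * (I l m t \<omega>)\<^sup>2))"
      unfolding H_def by (intro sum_mono) auto
    also have "\<dots> = 2 * A\<^sup>2 * (\<Sum>l\<in>{\<kappa><..N}. \<Sum>m = - int l..int l. (inner (X0 \<omega>) (harm l m))\<^sup>2)
       + 2 * (\<Sum>l\<in>{\<kappa><..N}. \<Sum>m = - int l..int l. w l * (I l m t \<omega>)\<^sup>2)"
      by (simp add: sum.distrib sum_distrib_left)
    also have "(\<Sum>l\<in>{\<kappa><..N}. \<Sum>m = - int l..int l. (inner (X0 \<omega>) (harm l m))\<^sup>2)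
       \<le> (\<Sum>l\<le>N. \<Sum>m = - int l..int l. (inner (X0 \<omega>) (harm l m))\<^sup>2)"
      by (intro sum_mono2) (auto intro: sum_nonneg)
    also have "\<dots> \<le> (norm (X0 \<omega>))\<^sup>2" by (rule bessel_harm)
    finally show ?thesis by (simp add: mult_left_mono)
  qed
  have Uint: "integrable M (\<lambda>\<omega>. 2 * A\<^sup>2 * (norm (X0 \<omega>))\<^sup>2
      + 2 * (\<Sum>l\<in>{\<kappa><..N}. \<Sum>m = - int l..int l. w l * (I l m t \<omega>)\<^sup>2))" for N
    by (intro Bochner_Integration.integrable_add integrable_mult_right X0(2) Bochner_Integration.integrable_sum I(2)) auto
  have Hint: "integrable M (H N)" for N
    by (rule Bochner_Integration.integrable_bound[OF Uint Hm])
       (use Hle H0 in \<open>auto intro!: AE_I2 intro: order.trans[OF _ abs_ge_self]\<close>)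
  have EH: "expectation (H N) \<le> (2 * (A * a + B))\<^sup>2" for N
  proof -
    have "expectation (H N) \<le> (\<integral>\<omega>. 2 * A\<^sup>2 * (norm (X0 \<omega>))\<^sup>2
      + 2 * (\<Sum>l\<in>{\<kappa><..N}. \<Sum>m = - int l..int l. w l * (I l m t \<omega>)\<^sup>2) \<partial>M)"
      by (intro integral_mono Hint Uint Hle)
    also have "\<dots> = 2 * A\<^sup>2 * a\<^sup>2 + 2 * (\<integral>\<omega>. (\<Sum>l\<in>{\<kappa><..N}. \<Sum>m = - int l..int l. w l * (I l m t \<omega>)\<^sup>2) \<partial>M)"
      unfolding a2 using X0(2)
      by (subst Bochner_Integration.integral_add)
         (auto intro!: Bochner_Integration.integrable_sum I(2))
    also have "(\<integral>\<omega>. (\<Sum>l\<in>{\<kappa><..N}. \<Sum>m = - int l..int l. w l * (I l m t \<omega>)\<^sup>2) \<partial>M)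
       = (\<Sum>l\<in>{\<kappa><..N}. \<integral>\<omega>. (\<Sum>m = - int l..int l. w l * (I l m t \<omega>)\<^sup>2) \<partial>M)"
      by (intro Bochner_Integration.integral_sum Bochner_Integration.integrable_sum integrable_mult_right I(2)) auto
    also have "\<dots> = (\<Sum>l\<in>{\<kappa><..N}. \<Sum>m = - int l..int l. \<integral>\<omega>. w l * (I l m t \<omega>)\<^sup>2 \<partial>M)"
      by (intro sum.cong refl Bochner_Integration.integral_sum integrable_mult_right I(2)) auto
    also have "\<dots> \<le> B\<^sup>2"
      using B(2)[of N] by (simp add: w_def lam_def)
    also have "2 * A\<^sup>2 * a\<^sup>2 + 2 * B\<^sup>2 \<le> (2 * (A * a + B))\<^sup>2"
    proof -
      have "0 \<le> A * a * B" "0 \<le> (A * a)\<^sup>2" "0 \<le> B\<^sup>2" using A0 a0 B(1) by auto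
      then show ?thesis by (simp add: power2_eq_square algebra_simps)
    qed
    finally show ?thesis by simp
  qed

  have bound: "(\<integral>\<^sup>+\<omega>. ennreal \<bar>S N \<omega>\<bar> \<partial>M) \<le> ennreal (2 * K * (A * a + B))" for N
  proof -
    have "(\<integral>\<^sup>+\<omega>. ennreal \<bar>S N \<omega>\<bar> \<partial>M) \<le> (\<integral>\<^sup>+\<omega>. ennreal (sqrt (H N \<omega>) * sobolev_norm \<rho> (Z \<omega>)) \<partial>M)"
      unfolding S_def H_def w_def lam_def
      by (intro nn_integral_mono ennreal_leI tail_pairing_le Zs) auto
    also have "\<dots> \<le> ennreal (sqrt (\<integral>\<omega>. (sqrt (H N \<omega>))\<^sup>2 \<partial>M) * sqrt (\<integral>\<omega>. (sobolev_norm \<rho> (Z \<omega>))\<^sup>2 \<partial>M))"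
      by (rule nn_integral_mult_le_L2)
         (use Hint Hm H0 Zi Zn sobolev_norm_nonneg Zs in \<open>auto intro: measurable_compose[OF _ borel_measurable_sqrt]\<close>)
    also have "\<dots> \<le> ennreal ((2 * (A * a + B)) * K)"
    proof (intro ennreal_leI mult_mono)
      have "sqrt (expectation (H N)) \<le> sqrt ((2 * (A * a + B))\<^sup>2)" using EH by (rule real_sqrt_le_mono)
      then show "sqrt (\<integral>\<omega>. (sqrt (H N \<omega>))\<^sup>2 \<partial>M) \<le> 2 * (A * a + B)"
        using A0 a0 B(1) H0 by simp
      show "sqrt (\<integral>\<omega>. (sobolev_norm \<rho> (Z \<omega>))\<^sup>2 \<partial>M) \<le> K" using Z(2) by (simp add: L2_norm_def)
    qed (use A0 a0 B(1) in auto)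
    finally show ?thesis by (simp add: mult_ac)
  qed

  \<comment> \<open>The coefficients of the averaged derivative are \<open>Z\<close>, so the pairing of \<open>J\<close> with the tail of the
    expansion is the limit of the finite sums.\<close>
  have lim: "AE \<omega> in M. (\<lambda>N. S N \<omega>) \<longlonglongrightarrow> \<phi> (x \<omega>) - \<phi> (s \<omega>)"
    using x seg Z(3)
  proof eventually_elim
    case (elim \<omega>)
    define J where "J = integral {0..1} (\<lambda>y. \<phi>' (y *\<^sub>R x \<omega> + (1 - y) *\<^sub>R s \<omega>))"
    have ZJ: "Z \<omega> l m = inner J (harm l m)" if "- int l \<le> m" "m \<le> int l" for l m
      using elim(3) that by (simp add: sph_coeffs_def J_def)
    have S: "S N \<omega> = inner J ((\<Sum>l\<le>N. solution_part X0 I l t \<omega>) - s \<omega>)" if "\<kappa> \<le> N" for N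
    proof -
      have "{..N} = {..\<kappa>} \<union> {\<kappa><..N}" using that by auto
      then have "(\<Sum>l\<le>N. solution_part X0 I l t \<omega>) = s \<omega> + (\<Sum>l\<in>{\<kappa><..N}. solution_part X0 I l t \<omega>)"
        unfolding s_def spectral_approx_def by (simp only:) (rule sum.union_disjoint, auto)
      then have "inner J ((\<Sum>l\<le>N. solution_part X0 I l t \<omega>) - s \<omega>) = (\<Sum>l\<in>{\<kappa><..N}. inner J (solution_part X0 I l t \<omega>))"
        by (simp add: inner_sum_right)
      also have "\<dots> = S N \<omega>"
        unfolding S_def solution_part_def inner_sum_right
        by (intro sum.cong refl) (simp add: ZJ c_def lam_def)
      finally show ?thesis by simp
    qed
    have "(\<lambda>N. \<Sum>l\<le>N. solution_part X0 I l t \<omega>) \<longlonglongrightarrow> x \<omega>"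
      using elim(1) by (simp add: sums_def_le)
    then have "(\<lambda>N. inner J ((\<Sum>l\<le>N. solution_part X0 I l t \<omega>) - s \<omega>)) \<longlonglongrightarrow> inner J (x \<omega> - s \<omega>)"
      by (intro tendsto_intros)
    moreover have "\<forall>\<^sub>F N in sequentially. inner J ((\<Sum>l\<le>N. solution_part X0 I l t \<omega>) - s \<omega>) = S N \<omega>"
      using eventually_ge_at_top[of \<kappa>] by eventually_elim (simp add: S)
    ultimately have "(\<lambda>N. S N \<omega>) \<longlonglongrightarrow> inner J (x \<omega> - s \<omega>)"
      by (rule Lim_transform_eventually)
    then show ?case
      using GDERIV_segment_integral[OF \<phi> elim(2)] by (simp add: J_def)
  qed
  show ?thesis
    using integral_le_of_AE_limit[OF Sm lim bound] K0 A0 a0 B(1)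
    by (simp add: A_def a_def)
qed

theorem theorem3p4:
  fixes M :: "'w measure" and F :: "real \<Rightarrow> 'w measure" and T \<eta> \<rho> K \<beta> :: real
    and L :: "real \<Rightarrow> 'w \<Rightarrow> coeffs" and X0 :: "'w \<Rightarrow> l2_sphere"
    and I :: "nat \<Rightarrow> int \<Rightarrow> real \<Rightarrow> 'w \<Rightarrow> real" and X :: "real \<Rightarrow> 'w \<Rightarrow> l2_sphere"
    and \<phi> :: "l2_sphere \<Rightarrow> real" and \<phi>' :: "l2_sphere \<Rightarrow> l2_sphere"
  defines "mL \<equiv> \<lambda>l m. \<integral>\<omega>. L 1 \<omega> l m \<partial>M"
  defines "vL \<equiv> \<lambda>l m. \<integral>\<omega>. (L 1 \<omega> l m - mL l m)\<^sup>2 \<partial>M"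
  assumes "prob_space M" and "complete_measure M" and "0 \<le> T" and "complete_filtration M T F"
    and "- 1 < \<eta>"
    and "levy_process M (sobolev_borel \<eta>) (sobolev_norm \<eta>) L"
    and "\<forall>t\<ge>0. L t \<in> L2_sobolev M \<eta>"
    and "X0 \<in> borel_measurable (F 0)" and "integrable M (\<lambda>\<omega>. (norm (X0 \<omega>))\<^sup>2)"
    and "indep_of_process M X0 (sobolev_borel \<eta>) L"
    and "\<forall>l m. \<forall>t\<in>{0..T}. \<bar>m\<bar> \<le> int l \<longrightarrow>
           has_levy_integral M (\<lambda>s \<omega>. L s \<omega> l m)
             (\<lambda>s. exp (- (real l * (real l + 1)) * (t - s))) t (I l m t)"
    and "\<forall>t\<in>{0..T}. AE \<omega> in M. (\<lambda>l. solution_part X0 I l t \<omega>) sums X t \<omega>"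
    and "\<forall>f. GDERIV \<phi> f :> \<phi>' f"
    and "0 \<le> \<rho>"
    and "\<forall>\<kappa>\<ge>1. \<forall>t\<in>{0..T}.
           (AE \<omega> in M. (\<lambda>y. \<phi>' (y *\<^sub>R X t \<omega> + (1 - y) *\<^sub>R spectral_approx X0 I \<kappa> t \<omega>))
              integrable_on {0..1::real}) \<and>
           (\<exists>Z\<in>L2_sobolev M \<rho>.
              (AE \<omega> in M. Z \<omega> = sph_coeffs (integral {0..1}
                 (\<lambda>y. \<phi>' (y *\<^sub>R X t \<omega> + (1 - y) *\<^sub>R spectral_approx X0 I \<kappa> t \<omega>)))) \<and>
              L2_norm M (sobolev_norm \<rho>) Z \<le> K)"
    and "(summable (\<lambda>l. \<Sum>m = - int l..int l.
              (1 + real l * (real l + 1)) powr \<eta> * (vL l m + (mL l m)\<^sup>2))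
            \<and> \<beta> = \<eta> + 1)
         \<or>
         (\<exists>\<alpha> C' mh vh. \<exists>a :: nat \<Rightarrow> real. \<exists>Lh :: nat \<Rightarrow> int \<Rightarrow> real \<Rightarrow> 'w \<Rightarrow> real.
            0 < \<alpha> \<and> 0 \<le> a 0 \<and> (\<forall>l\<ge>1. \<bar>a l\<bar> \<le> C' * real l powr (- \<alpha> / 2)) \<and>
            (\<forall>l m. \<bar>m\<bar> \<le> int l \<longrightarrow>
               levy_process M borel abs (Lh l m) \<and>
               (AE \<omega> in M. \<forall>t\<ge>0. L t \<omega> l m = a l * Lh l m t \<omega>) \<and>
               (\<forall>t\<ge>0. integrable M (\<lambda>\<omega>. (Lh l m t \<omega>)\<^sup>2) \<and>
                  (\<integral>\<omega>. Lh l m t \<omega> \<partial>M) = t * mh \<and>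
                  (\<integral>\<omega>. (Lh l m t \<omega> - t * mh)\<^sup>2 \<partial>M) = t * vh)) \<and>
            (\<forall>l m l' m'. \<bar>m\<bar> \<le> int l \<and> \<bar>m'\<bar> \<le> int l' \<longrightarrow>
               distr M (PiM {0..} (\<lambda>_. borel)) (\<lambda>\<omega>. \<lambda>t\<in>{0..}. Lh l m t \<omega>) =
               distr M (PiM {0..} (\<lambda>_. borel)) (\<lambda>\<omega>. \<lambda>t\<in>{0..}. Lh l' m' t \<omega>)) \<and>
            \<beta> = \<alpha> / 2)"
  shows "\<exists>C. \<forall>\<kappa>\<ge>1. \<forall>t\<in>{0..T}.
           integrable M (\<lambda>\<omega>. \<phi> (X t \<omega>) - \<phi> (spectral_approx X0 I \<kappa> t \<omega>)) \<and>
           \<bar>\<integral>\<omega>. \<phi> (X t \<omega>) - \<phi> (spectral_approx X0 I \<kappa> t \<omega>) \<partial>M\<bar>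
             \<le> C * exp (- (real \<kappa> + 1)\<^sup>2 * t) * (real \<kappa> + 1) powr (- \<rho>) * L2_norm M norm X0
               + C * real \<kappa> powr (- (\<beta> + \<rho>))"
proof -
  interpret prob_space M by (rule assms(3))
  interpret levy_L2 M \<eta> L by unfold_locales (use assms(8,9) in auto)
  define Q where "Q l = (\<Sum>m = - int l..int l. vL l m + (mL l m)\<^sup>2)" for l
  have vL0: "0 \<le> vL l m" for l m by (simp add: vL_def)
  then have Q0: "0 \<le> Q l" for l unfolding Q_def by (intro sum_nonneg add_nonneg_nonneg) auto
  have "\<exists>D\<ge>0. \<forall>\<kappa>\<ge>1. \<forall>N. (\<Sum>l\<in>{\<kappa><..N}. (1 + real l * (real l + 1)) powr (- \<rho>) * (Q l / (real l * (real l + 1))))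
      \<le> D * (real \<kappa> powr (- (\<beta> + \<rho>)))\<^sup>2"
    using assms(18)
  proof (elim disjE exE conjE)
    assume sm: "summable (\<lambda>l. \<Sum>m = - int l..int l. (1 + real l * (real l + 1)) powr \<eta> * (vL l m + (mL l m)\<^sup>2))"
      and \<beta>: "\<beta> = \<eta> + 1"
    show ?thesis
      unfolding \<beta>
    proof (rule noise_tail_summable)
      show "summable (\<lambda>l. (1 + real l * (real l + 1)) powr \<eta> * Q l)"
        using sm by (simp add: Q_def sum_distrib_left)
    qed (use Q0 assms(7,16) in auto)
  next
    fix \<alpha> C' mh vh :: real and a :: "nat \<Rightarrow> real" and Lh :: "nat \<Rightarrow> int \<Rightarrow> real \<Rightarrow> 'w \<Rightarrow> real"
    assume \<alpha>: "0 < \<alpha>" "\<beta> = \<alpha> / 2"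
      and a: "\<forall>l\<ge>1. \<bar>a l\<bar> \<le> C' * real l powr (- \<alpha> / 2)"
      and Lh: "\<forall>l m. \<bar>m\<bar> \<le> int l \<longrightarrow>
               levy_process M borel abs (Lh l m) \<and>
               (AE \<omega> in M. \<forall>t\<ge>0. L t \<omega> l m = a l * Lh l m t \<omega>) \<and>
               (\<forall>t\<ge>0. integrable M (\<lambda>\<omega>. (Lh l m t \<omega>)\<^sup>2) \<and>
                  (\<integral>\<omega>. Lh l m t \<omega> \<partial>M) = t * mh \<and>
                  (\<integral>\<omega>. (Lh l m t \<omega> - t * mh)\<^sup>2 \<partial>M) = t * vh)"
    \<comment> \<open>The moments depend on the degree only, through \<open>a l\<close>.\<close>
    have mom: "mL l m = a l * mh \<and> vL l m = (a l)\<^sup>2 * vh" if lm: "\<bar>m\<bar> \<le> int l" for l m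
    proof -
      have lev: "levy_process M borel abs (Lh l m)"
        and ae: "AE \<omega> in M. L 1 \<omega> l m = a l * Lh l m 1 \<omega>"
        and "\<forall>t\<ge>0. (\<integral>\<omega>. Lh l m t \<omega> \<partial>M) = t * mh \<and> (\<integral>\<omega>. (Lh l m t \<omega> - t * mh)\<^sup>2 \<partial>M) = t * vh"
        using Lh lm by fastforce+
      from this(3)[rule_format, of 1]
      have mean: "(\<integral>\<omega>. Lh l m 1 \<omega> \<partial>M) = mh" and var: "(\<integral>\<omega>. (Lh l m 1 \<omega> - mh)\<^sup>2 \<partial>M) = vh"
        by auto
      have [measurable]: "Lh l m 1 \<in> borel_measurable M" "(\<lambda>\<omega>. L 1 \<omega> l m) \<in> borel_measurable M"
        using lev coeff_measurable[OF _ lm, of 1] by (auto simp: levy_process_def)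
      have "mL l m = (\<integral>\<omega>. a l * Lh l m 1 \<omega> \<partial>M)"
        unfolding mL_def by (intro integral_cong_AE ae) measurable
      then have mL: "mL l m = a l * mh" by (simp add: mean)
      have "vL l m = (\<integral>\<omega>. (a l)\<^sup>2 * (Lh l m 1 \<omega> - mh)\<^sup>2 \<partial>M)"
        unfolding vL_def mL
      proof (rule integral_cong_AE)
        show "AE \<omega> in M. (L 1 \<omega> l m - a l * mh)\<^sup>2 = (a l)\<^sup>2 * (Lh l m 1 \<omega> - mh)\<^sup>2"
          using ae by eventually_elim (simp add: power_mult_distrib[symmetric] algebra_simps)
      qed measurable
      with mL var show ?thesis by simp
    qed
    have vh: "0 \<le> vh"
    proof -
      have "\<forall>t\<ge>0. (\<integral>\<omega>. (Lh 0 0 t \<omega> - t * mh)\<^sup>2 \<partial>M) = t * vh"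
        using Lh[rule_format, of 0 0] by simp
      from this[rule_format, of 1] have "vh = (\<integral>\<omega>. (Lh 0 0 1 \<omega> - mh)\<^sup>2 \<partial>M)" by simp
      then show ?thesis by simp
    qed
    have "Q l \<le> (2 * real l + 1) * (C'\<^sup>2 * (vh + mh\<^sup>2) * real l powr (- \<alpha>))" if l: "1 \<le> l" for l
    proof -
      have "Q l = (\<Sum>m = - int l..int l. (a l)\<^sup>2 * (vh + mh\<^sup>2))"
        unfolding Q_def using mom by (intro sum.cong refl) (auto simp: power_mult_distrib algebra_simps)
      also have "\<dots> = (2 * real l + 1) * ((a l)\<^sup>2 * (vh + mh\<^sup>2))" by simp
      also have "(a l)\<^sup>2 \<le> (C' * real l powr (- \<alpha> / 2))\<^sup>2"
        using a l by (simp add: abs_le_square_iff[symmetric] order.trans[OF _ abs_ge_self])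
      also have "\<dots> = C'\<^sup>2 * real l powr (- \<alpha>)"
        using l by (simp add: power_mult_distrib powr_power)
      finally show ?thesis using vh by (simp add: mult_left_mono mult_right_mono mult_ac)
    qed
    then show ?thesis
      unfolding \<alpha>(2) by (rule noise_tail_polynomial) (use vh \<alpha> assms(16) in auto)
  qed
  then obtain D where D: "0 \<le> D" and tail: "\<And>\<kappa> N. 1 \<le> \<kappa> \<Longrightarrow>
      (\<Sum>l\<in>{\<kappa><..N}. (1 + real l * (real l + 1)) powr (- \<rho>) * (Q l / (real l * (real l + 1))))
        \<le> D * (real \<kappa> powr (- (\<beta> + \<rho>)))\<^sup>2" by blast
  \<comment> \<open>Two constants enter: \<open>2(1 + T)\<close> from the second moments of the convolutions and \<open>D\<close> from the tails.\<close>
  define E where "E = sqrt (2 * (1 + T) * D)"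
  have E: "0 \<le> E" "E\<^sup>2 = 2 * (1 + T) * D" using D assms(5) by (simp_all add: E_def)
  have X0: "X0 \<in> borel_measurable M"
    using assms(6,10,5) by (auto simp: complete_filtration_def intro: measurable_from_subalg)
  have conv: "integrable M (\<lambda>\<omega>. (I l m t \<omega>)\<^sup>2)"
      "(\<integral>\<omega>. (I l m t \<omega>)\<^sup>2 \<partial>M) \<le> 2 * (1 + T) * (vL l m + (mL l m)\<^sup>2) / (real l * (real l + 1))"
    if "t \<in> {0..T}" "\<bar>m\<bar> \<le> int l" "0 < l" for l m t
    using levy_convolution_second_moment[OF that(2), where a = "real l * (real l + 1)" and t = t and T = T and I = "I l m t"]
      assms(13) that by (auto simp: vL_def mL_def)
  have main: "integrable M (\<lambda>\<omega>. \<phi> (X t \<omega>) - \<phi> (spectral_approx X0 I \<kappa> t \<omega>)) \<and>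
      \<bar>\<integral>\<omega>. \<phi> (X t \<omega>) - \<phi> (spectral_approx X0 I \<kappa> t \<omega>) \<partial>M\<bar>
        \<le> 2 * K * (exp (- (real \<kappa> + 1)\<^sup>2 * t) * (real \<kappa> + 1) powr (- \<rho>) * L2_norm M norm X0
          + E * real \<kappa> powr (- (\<beta> + \<rho>)))" if \<kappa>: "1 \<le> \<kappa>" and t: "t \<in> {0..T}" for \<kappa> t
  proof -
    obtain Z where Z: "Z \<in> L2_sobolev M \<rho>" "L2_norm M (sobolev_norm \<rho>) Z \<le> K"
      "AE \<omega> in M. Z \<omega> = sph_coeffs (integral {0..1}
         (\<lambda>y. \<phi>' (y *\<^sub>R X t \<omega> + (1 - y) *\<^sub>R spectral_approx X0 I \<kappa> t \<omega>)))"
      and seg: "AE \<omega> in M. (\<lambda>y. \<phi>' (y *\<^sub>R X t \<omega> + (1 - y) *\<^sub>R spectral_approx X0 I \<kappa> t \<omega>))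
              integrable_on {0..1::real}"
      using assms(17) \<kappa> t by blast
    show ?thesis
    proof (rule weak_error_bound[OF assms(3,4) X0 assms(11) _ _ _ _ _ _ seg Z])
      show "I l m t \<in> borel_measurable M" if "\<bar>m\<bar> \<le> int l" for l m
        using assms(13) that t by (auto simp: has_levy_integral_def)
      show "integrable M (\<lambda>\<omega>. (I l m t \<omega>)\<^sup>2)" if "\<bar>m\<bar> \<le> int l" "\<kappa> < l" for l m
        using conv(1)[OF t that(1)] that by simp
      show "(\<Sum>l\<in>{\<kappa><..N}. \<Sum>m = - int l..int l. (1 + real l * (real l + 1)) powr (- \<rho>) * (\<integral>\<omega>. (I l m t \<omega>)\<^sup>2 \<partial>M))
        \<le> (E * real \<kappa> powr (- (\<beta> + \<rho>)))\<^sup>2" for N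
      proof -
        have "(\<Sum>l\<in>{\<kappa><..N}. \<Sum>m = - int l..int l. (1 + real l * (real l + 1)) powr (- \<rho>) * (\<integral>\<omega>. (I l m t \<omega>)\<^sup>2 \<partial>M))
          \<le> (\<Sum>l\<in>{\<kappa><..N}. \<Sum>m = - int l..int l. (1 + real l * (real l + 1)) powr (- \<rho>)
             * (2 * (1 + T) * (vL l m + (mL l m)\<^sup>2) / (real l * (real l + 1))))"
          by (intro sum_mono mult_left_mono conv(2) t) auto
        also have "\<dots> = 2 * (1 + T) * (\<Sum>l\<in>{\<kappa><..N}. (1 + real l * (real l + 1)) powr (- \<rho>) * (Q l / (real l * (real l + 1))))"
          by (simp add: Q_def sum_distrib_left sum_divide_distrib mult_ac)
        also have "\<dots> \<le> 2 * (1 + T) * (D * (real \<kappa> powr (- (\<beta> + \<rho>)))\<^sup>2)"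
          using assms(5) by (intro mult_left_mono tail \<kappa>) auto
        also have "\<dots> = (E * real \<kappa> powr (- (\<beta> + \<rho>)))\<^sup>2"
          by (simp add: power_mult_distrib E(2))
        finally show ?thesis .
      qed
      show "AE \<omega> in M. (\<lambda>l. solution_part X0 I l t \<omega>) sums X t \<omega>" using assms(14) t by blast
    qed (use assms(15,16) t E in auto)
  qed
  have K: "0 \<le> K"
  proof -
    obtain Z where "L2_norm M (sobolev_norm \<rho>) Z \<le> K"
      using assms(17)[rule_format, of 1 0] assms(5) by auto
    then show ?thesis by (rule order.trans[rotated]) (simp add: L2_norm_def)
  qed
  define C where "C = 2 * K * (1 + E)"
  have C: "2 * K \<le> C" "2 * K * E \<le> C" using K E by (simp_all add: C_def algebra_simps)
  show ?thesis
  proof (intro exI[of _ C] allI impI ballI conjI)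
    fix \<kappa> :: nat and t assume \<kappa>: "1 \<le> \<kappa>" and t: "t \<in> {0..T}"
    show "integrable M (\<lambda>\<omega>. \<phi> (X t \<omega>) - \<phi> (spectral_approx X0 I \<kappa> t \<omega>))"
      using main[OF \<kappa> t] by simp
    let ?d = "exp (- (real \<kappa> + 1)\<^sup>2 * t) * (real \<kappa> + 1) powr (- \<rho>) * L2_norm M norm X0"
    let ?r = "real \<kappa> powr (- (\<beta> + \<rho>))"
    have "\<bar>\<integral>\<omega>. \<phi> (X t \<omega>) - \<phi> (spectral_approx X0 I \<kappa> t \<omega>) \<partial>M\<bar> \<le> 2 * K * ?d + 2 * K * E * ?r"
      using main[OF \<kappa> t] by (simp add: algebra_simps)
    also have "\<dots> \<le> C * ?d + C * ?r"
      using C by (intro add_mono mult_right_mono) (auto simp: L2_norm_def)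
    finally show "\<bar>\<integral>\<omega>. \<phi> (X t \<omega>) - \<phi> (spectral_approx X0 I \<kappa> t \<omega>) \<partial>M\<bar>
        \<le> C * exp (- (real \<kappa> + 1)\<^sup>2 * t) * (real \<kappa> + 1) powr (- \<rho>) * L2_norm M norm X0
          + C * real \<kappa> powr (- (\<beta> + \<rho>))" by (simp only: mult.assoc)
  qed
qed

end
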